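(* For every positive integer $n$, the symmetric border rank of the monomial $x_1\cdots x_{2n+1}\in S^{2n+1}\mathbb{C}^{2n+1}$ (where $x_1,\dots,x_{2n+1}$ is a basis of $\mathbb{C}^{2n+1}$) satisfies $$\underline{\mathbf{R}}_S(x_1\cdots x_{2n+1})\ge\binom{2n+1}{n}\left(1+\frac{n^2}{(n+1)^2(2n-1)}\right).$$
   Context: For a finite-dimensional complex vector space $V$, the Veronese variety is $v_d(\mathbb{P}V)=\mathbb{P}\{z\in S^dV\mid z=w^d\text{ for some }w\in V\}\subset\mathbb{P}S^dV$. For a projective variety $X\subset\mathbb{P}U$, its $r$-th secant variety $\sigma_r(X)$ is the Zariski closure of the union of the linear spans $\langle p_1,\dots,p_r\rangle$ over all $p_1,\dots,p_r\in X$. The symmetric border rank $\underline{\mathbf{R}}_S(P)$ of $P\in S^dV$ is the smallest $r$ such that $[P]\in\sigma_r(v_d(\mathbb{P}V))$. *)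

theory Defs
  imports Complex_Main "HOL-Library.Poly_Mapping"
begin

text \<open>
  Polynomials with complex coefficients in variables indexed by \<open>'i\<close> are finitely supported
  families of coefficients indexed by monomials, i.e. by finitely supported exponent vectors.
\<close>

type_synonym 'i poly_C = "('i \<Rightarrow>\<^sub>0 nat) \<Rightarrow>\<^sub>0 complex"

definition Var :: "'i \<Rightarrow> 'i poly_C" where
  "Var i = Poly_Mapping.single (Poly_Mapping.single i 1) 1"

definition mdegree :: "('i \<Rightarrow>\<^sub>0 nat) \<Rightarrow> nat" where
  "mdegree m = (\<Sum>i\<in>Poly_Mapping.keys m. Poly_Mapping.lookup m i)"

definition homogeneous :: "nat \<Rightarrow> 'i poly_C \<Rightarrow> bool" where
  "homogeneous d F \<longleftrightarrow> (\<forall>m\<in>Poly_Mapping.keys F. mdegree m = d)"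

definition peval :: "'i poly_C \<Rightarrow> ('i \<Rightarrow> complex) \<Rightarrow> complex" where
  "peval F a = (\<Sum>m\<in>Poly_Mapping.keys F. Poly_Mapping.lookup F m *
                  (\<Prod>i\<in>Poly_Mapping.keys m. a i ^ Poly_Mapping.lookup m i))"

text \<open>
  For a complex vector space \<open>V\<close> with basis \<open>Var i\<close>, \<open>i \<in> I\<close>, the symmetric power \<open>S\<^sup>d V\<close> is the
  space of forms of degree \<open>d\<close> in these variables; \<open>V\<close> itself is \<open>sym_power 1 I\<close>, and the
  product of the symmetric algebra is the product of polynomials.
\<close>

definition sym_power :: "nat \<Rightarrow> 'i set \<Rightarrow> 'i poly_C set" where
  "sym_power d I = {P. homogeneous d P \<and> (\<forall>m\<in>Poly_Mapping.keys P. Poly_Mapping.keys m \<subseteq> I)}"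

text \<open>
  Projective geometry is set up in the vector space of finitely supported families
  \<open>'a \<Rightarrow>\<^sub>0 complex\<close>, whose linear coordinates are the functions \<open>\<lambda>u. Poly_Mapping.lookup u a\<close>.
\<close>

definition cscale :: "complex \<Rightarrow> ('a \<Rightarrow>\<^sub>0 complex) \<Rightarrow> ('a \<Rightarrow>\<^sub>0 complex)" where
  "cscale c u = Poly_Mapping.map ((*) c) u"

lemma lookup_cscale [simp]: "Poly_Mapping.lookup (cscale c u) a = c * Poly_Mapping.lookup u a"
  by (simp add: cscale_def Poly_Mapping.map.rep_eq when_def)

global_interpretation cvec: vector_space "cscale :: complex \<Rightarrow> ('a \<Rightarrow>\<^sub>0 complex) \<Rightarrow> _"
  by unfold_locales
    (auto intro!: poly_mapping_eqI simp: Poly_Mapping.lookup_add algebra_simps)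

text \<open>A point of projective space is a one-dimensional linear subspace.\<close>

definition proj_point :: "('a \<Rightarrow>\<^sub>0 complex) \<Rightarrow> ('a \<Rightarrow>\<^sub>0 complex) set" where
  "proj_point u = cvec.span {u}"

definition proj :: "('a \<Rightarrow>\<^sub>0 complex) set \<Rightarrow> ('a \<Rightarrow>\<^sub>0 complex) set set" where
  "proj S = proj_point ` (S - {0})"

definition vanishes_at :: "'a poly_C \<Rightarrow> ('a \<Rightarrow>\<^sub>0 complex) set \<Rightarrow> bool" where
  "vanishes_at F p \<longleftrightarrow> (\<forall>u\<in>p - {0}. peval F (Poly_Mapping.lookup u) = 0)"

text \<open>
  Zariski closure in the projective space of a linear subspace \<open>U\<close>. Every homogeneous polynomial
  function on \<open>U\<close> is the restriction of a homogeneous polynomial in the ambient coordinates,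
  so it suffices to quantify over the latter.
\<close>

definition zariski_closure ::
    "('a \<Rightarrow>\<^sub>0 complex) set \<Rightarrow> ('a \<Rightarrow>\<^sub>0 complex) set set \<Rightarrow> ('a \<Rightarrow>\<^sub>0 complex) set set" where
  "zariski_closure U Z =
     {p \<in> proj U. \<forall>k F. homogeneous k F \<longrightarrow> (\<forall>q\<in>Z. vanishes_at F q) \<longrightarrow> vanishes_at F p}"

definition proj_span :: "('a \<Rightarrow>\<^sub>0 complex) set set \<Rightarrow> ('a \<Rightarrow>\<^sub>0 complex) set set" where
  "proj_span A = proj (cvec.span (\<Union>A))"

text \<open>The points spanning a secant are given by a list, so they need not be distinct.\<close>

definition secant_variety ::
    "('a \<Rightarrow>\<^sub>0 complex) set \<Rightarrow> nat \<Rightarrow> ('a \<Rightarrow>\<^sub>0 complex) set set \<Rightarrow> ('a \<Rightarrow>\<^sub>0 complex) set set" where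
  "secant_variety U r X =
     zariski_closure U (\<Union>ps\<in>{ps. length ps = r \<and> set ps \<subseteq> X}. proj_span (set ps))"

definition veronese :: "nat \<Rightarrow> 'i set \<Rightarrow> 'i poly_C set set" where
  "veronese d I = proj {z \<in> sym_power d I. \<exists>w\<in>sym_power 1 I. z = w ^ d}"

text \<open>Meaningful for nonzero \<open>P \<in> sym_power d I\<close>, where such an \<open>r\<close> exists.\<close>

definition sym_border_rank :: "nat \<Rightarrow> 'i set \<Rightarrow> 'i poly_C \<Rightarrow> nat" where
  "sym_border_rank d I P =
     (LEAST r. proj_point P \<in> secant_variety (sym_power d I) r (veronese d I))"

end

theory Submission
  imports Defs "Jordan_Normal_Form.Determinant"
begin

text \<open>
  Let \<open>N = 2 n + 1\<close>. A form \<open>P\<close> of degree \<open>N\<close> in \<open>N\<close> variables has a Koszul flattening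
  \<open>S\<^sup>n V\<^sup>* \<otimes> \<Lambda>\<^sup>n V \<rightarrow> S\<^sup>n V \<otimes> \<Lambda>\<^sup>n\<^sup>+\<^sup>1 V\<close>, which is linear in \<open>P\<close>. For \<open>P = w\<^sup>N\<close> it is the tensor product
  of a map of rank one with \<open>w \<and> _\<close>, so its rank is at most \<open>2 n choose n\<close>; hence all minors of size
  greater than \<open>r (2 n choose n)\<close> vanish on the \<open>r\<close>-th secant variety.

  For the monomial \<open>x\<^sub>1 \<cdots> x\<^sub>N\<close> the flattening only involves pairs \<open>(A, B)\<close> of \<open>n\<close>-subsets of the
  variables and splits, by multidegree, into blocks on which \<open>A - B\<close> and \<open>B - A\<close> are constant. With
  \<open>s = |A \<inter> B|\<close>, such a block is the exterior multiplication \<open>\<Lambda>\<^sup>s \<rightarrow> \<Lambda>\<^sup>s\<^sup>+\<^sup>1\<close> by the sum of the basis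
  vectors on a set of \<open>2 s + 1\<close> elements, and has rank \<open>2 s choose s\<close>. A signed permutation matrix of
  this size is found in it. The total rank is the sum of \<open>(s + 1) / (2 s + 1)\<close> over all pairs, and since
  \<open>s\<close> has mean \<open>n\<^sup>2 / N\<close>, Jensen's inequality gives
  \<open>r \<ge> (N choose n) (1 + n / (2 n\<^sup>2 + 2 n + 1))\<close>. This implies the claim for \<open>n \<ge> 2\<close>; for \<open>n = 1\<close>
  it reads \<open>r \<ge> 18 / 5\<close>, so that \<open>r \<ge> 4\<close>.
\<close>

section \<open>Evaluation and homogeneity\<close>

definition meval :: "('i \<Rightarrow> complex) \<Rightarrow> ('i \<Rightarrow>\<^sub>0 nat) \<Rightarrow> complex" where
  "meval a m = (\<Prod>i\<in>Poly_Mapping.keys m. a i ^ Poly_Mapping.lookup m i)"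

lemma meval_superset:
  assumes "finite S" "Poly_Mapping.keys m \<subseteq> S"
  shows "meval a m = (\<Prod>i\<in>S. a i ^ Poly_Mapping.lookup m i)"
  unfolding meval_def using assms by (intro prod.mono_neutral_left) (auto simp: in_keys_iff)

lemma meval_add: "meval a (m + m') = meval a m * meval a m'"
proof -
  let ?S = "Poly_Mapping.keys m \<union> Poly_Mapping.keys m'"
  have "Poly_Mapping.keys (m + m') \<subseteq> ?S"
    by (rule Poly_Mapping.keys_add)
  then show ?thesis
    by (simp add: meval_superset[of ?S] Poly_Mapping.lookup_add power_add prod.distrib)
qed

lemma meval_0 [simp]: "meval a 0 = 1"
  by (simp add: meval_def)

lemma meval_single_1 [simp]: "meval a (Poly_Mapping.single i (Suc 0)) = a i"
  by (simp add: meval_def)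

lemma peval_superset:
  assumes "finite S" "Poly_Mapping.keys F \<subseteq> S"
  shows "peval F a = (\<Sum>m\<in>S. Poly_Mapping.lookup F m * meval a m)"
  unfolding peval_def meval_def
  using assms by (intro sum.mono_neutral_left) (auto simp: in_keys_iff)

lemma peval_single [simp]: "peval (Poly_Mapping.single m c) a = c * meval a m"
  by (subst peval_superset[of "{m}"]) auto

lemma peval_add: "peval (F + G) a = peval F a + peval G a"
proof -
  let ?S = "Poly_Mapping.keys F \<union> Poly_Mapping.keys G"
  have "Poly_Mapping.keys (F + G) \<subseteq> ?S"
    by (rule Poly_Mapping.keys_add)
  then show ?thesis
    by (simp add: peval_superset[of ?S] Poly_Mapping.lookup_add sum.distrib algebra_simps)
qed

lemma peval_0 [simp]: "peval 0 a = 0"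
  by (simp add: peval_def)

lemma peval_sum: "peval (sum f S) a = (\<Sum>i\<in>S. peval (f i) a)"
  by (induction S rule: infinite_finite_induct) (auto simp: peval_add)

lemma poly_mapping_eq_sum_single:
  "F = (\<Sum>m\<in>Poly_Mapping.keys F. Poly_Mapping.single m (Poly_Mapping.lookup F m))"
  by (rule poly_mapping_eqI)
     (simp add: Poly_Mapping.lookup_sum Poly_Mapping.lookup_single when_def in_keys_iff)

lemma peval_mult: "peval (F * G) a = peval F a * peval G a"
proof -
  have "F * G = (\<Sum>m\<in>Poly_Mapping.keys F. \<Sum>m'\<in>Poly_Mapping.keys G.
      Poly_Mapping.single (m + m') (Poly_Mapping.lookup F m * Poly_Mapping.lookup G m'))"
    by (subst poly_mapping_eq_sum_single[of F], subst poly_mapping_eq_sum_single[of G])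
       (simp add: sum_product Poly_Mapping.mult_single)
  moreover have "peval F a * peval G a = (\<Sum>m\<in>Poly_Mapping.keys F. \<Sum>m'\<in>Poly_Mapping.keys G.
      Poly_Mapping.lookup F m * Poly_Mapping.lookup G m' * meval a (m + m'))"
    by (simp add: peval_superset[OF finite_keys order_refl] sum_product meval_add mult_ac)
  ultimately show ?thesis
    by (simp add: peval_sum)
qed

text \<open>As a ring homomorphism, evaluation commutes with \<open>det\<close>, so a minor of a
  matrix of forms can be computed pointwise.\<close>

interpretation peval: comm_ring_hom "\<lambda>F. peval F a" for a
  by unfold_locales
     (simp_all add: peval_add peval_mult flip: Poly_Mapping.single_one)

lemma mdegree_superset:
  assumes "finite S" "Poly_Mapping.keys m \<subseteq> S"
  shows "mdegree m = (\<Sum>i\<in>S. Poly_Mapping.lookup m i)"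
  unfolding mdegree_def using assms by (intro sum.mono_neutral_left) (auto simp: in_keys_iff)

lemma mdegree_add: "mdegree (m + m') = mdegree m + mdegree m'"
proof -
  let ?S = "Poly_Mapping.keys m \<union> Poly_Mapping.keys m'"
  have "Poly_Mapping.keys (m + m') \<subseteq> ?S"
    by (rule Poly_Mapping.keys_add)
  then show ?thesis
    by (simp add: mdegree_superset[of ?S] Poly_Mapping.lookup_add sum.distrib)
qed

lemma mdegree_0 [simp]: "mdegree 0 = 0"
  by (simp add: mdegree_def)

lemma mdegree_single [simp]: "mdegree (Poly_Mapping.single i k) = k"
  by (simp add: mdegree_def)

lemma mdegree_eq_1E:
  assumes "mdegree m = 1"
  obtains i where "m = Poly_Mapping.single i 1"
proof -
  obtain i where i: "i \<in> Poly_Mapping.keys m" "Poly_Mapping.lookup m i = Suc 0"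
    "\<forall>j\<in>Poly_Mapping.keys m. i \<noteq> j \<longrightarrow> Poly_Mapping.lookup m j = 0"
    using assms sum_eq_Suc0_iff[OF finite_keys, of "Poly_Mapping.lookup m" m]
    by (auto simp: mdegree_def)
  then have "m = Poly_Mapping.single i 1"
    by (intro poly_mapping_eqI) (auto simp: Poly_Mapping.lookup_single when_def in_keys_iff)
  then show thesis by (rule that)
qed

lemma homogeneous_0 [simp]: "homogeneous k 0"
  by (simp add: homogeneous_def)

lemma homogeneous_single [simp]: "mdegree m = k \<Longrightarrow> homogeneous k (Poly_Mapping.single m c)"
  by (simp add: homogeneous_def)

lemma homogeneous_1 [simp]: "homogeneous 0 1"
  by (simp flip: Poly_Mapping.single_one)

lemma homogeneous_uminus [simp]: "homogeneous k (- F) \<longleftrightarrow> homogeneous k F"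
  by (simp add: homogeneous_def)

lemma homogeneous_add: "homogeneous k F \<Longrightarrow> homogeneous k G \<Longrightarrow> homogeneous k (F + G)"
  unfolding homogeneous_def using Poly_Mapping.keys_add[of F G] by blast

lemma homogeneous_sum: "(\<And>i. i \<in> S \<Longrightarrow> homogeneous k (f i)) \<Longrightarrow> homogeneous k (sum f S)"
  by (induction S rule: infinite_finite_induct) (auto simp: homogeneous_add)

lemma homogeneous_mult: "homogeneous k F \<Longrightarrow> homogeneous l G \<Longrightarrow> homogeneous (k + l) (F * G)"
  unfolding homogeneous_def using Poly_Mapping.keys_mult[of F G] by (fastforce simp: mdegree_add)

lemma homogeneous_prod:
  "(\<And>i. i \<in> S \<Longrightarrow> homogeneous (k i) (f i)) \<Longrightarrow> homogeneous (sum k S) (prod f S)"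
  by (induction S rule: infinite_finite_induct) (auto simp: homogeneous_mult)

text \<open>Every Leibniz term is a product of \<open>n\<close> linear entries times a sign, a
  constant of degree 0.\<close>

lemma homogeneous_det:
  assumes "A \<in> carrier_mat n n" "\<And>i j. i < n \<Longrightarrow> j < n \<Longrightarrow> homogeneous 1 (A $$ (i, j))"
  shows "homogeneous n (det A)"
  unfolding det_def'[OF assms(1)]
proof (rule homogeneous_sum)
  fix p assume p: "p \<in> {p. p permutes {0..<n}}"
  have "homogeneous (\<Sum>i=0..<n. 1) (\<Prod>i=0..<n. A $$ (i, p i))"
    using p by (intro homogeneous_prod assms(2)) (auto simp: permutes_in_image)
  then have "homogeneous n (\<Prod>i=0..<n. A $$ (i, p i))"
    by simp
  moreover have "homogeneous 0 (signof p :: 'a poly_C)"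
    by (cases p rule: sign_cases) auto
  ultimately show "homogeneous n (signof p * (\<Prod>i=0..<n. A $$ (i, p i)))"
    using homogeneous_mult by fastforce
qed

text \<open>Each monomial of degree 1 is a single variable. With the scaling rule below, vanishing
  conditions given by linear forms pass to spans.\<close>

lemma peval_homogeneous_1_add:
  assumes "homogeneous 1 F"
  shows "peval F (\<lambda>i. x i + y i) = peval F x + peval F y"
  unfolding peval_superset[OF finite_keys order_refl] sum.distrib[symmetric]
proof (rule sum.cong[OF refl])
  fix m assume "m \<in> Poly_Mapping.keys F"
  then obtain i where "m = Poly_Mapping.single i 1"
    using assms mdegree_eq_1E unfolding homogeneous_def by metis
  then show "Poly_Mapping.lookup F m * meval (\<lambda>i. x i + y i) m =
    Poly_Mapping.lookup F m * meval x m + Poly_Mapping.lookup F m * meval y m"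
    by (simp add: algebra_simps)
qed

lemma peval_homogeneous_1_scale:
  assumes "homogeneous 1 F"
  shows "peval F (\<lambda>i. c * x i) = c * peval F x"
  unfolding peval_superset[OF finite_keys order_refl] sum_distrib_left
proof (rule sum.cong[OF refl])
  fix m assume "m \<in> Poly_Mapping.keys F"
  then obtain i where "m = Poly_Mapping.single i 1"
    using assms mdegree_eq_1E unfolding homogeneous_def by metis
  then show "Poly_Mapping.lookup F m * meval (\<lambda>i. c * x i) m =
    c * (Poly_Mapping.lookup F m * meval x m)"
    by simp
qed

section \<open>Determinantal equations of secant varieties\<close>

text \<open>Gaussian elimination by induction on the equations: a nontrivial equation removes one
  unknown, so the surplus of unknowns persists.\<close>

lemma homogeneous_linear_system_nontrivial:
  fixes g :: "'c \<Rightarrow> 'b \<Rightarrow> 'k::field"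
  assumes "finite J" "finite I" "card J < card I"
  shows "\<exists>v. (\<exists>i\<in>I. v i \<noteq> 0) \<and> (\<forall>j\<in>J. (\<Sum>i\<in>I. g j i * v i) = 0)"
  using assms
proof (induction J arbitrary: I g rule: finite_induct)
  case empty
  then have "I \<noteq> {}" by auto
  then show ?case by (intro exI[of _ "\<lambda>_. 1"]) auto
next
  case (insert j J)
  show ?case
  proof (cases "\<forall>i\<in>I. g j i = 0")
    case True
    have "card J < card I" using insert by simp
    from insert.IH[OF \<open>finite I\<close> this, of g] True show ?thesis by auto
  next
    case False
    then obtain i0 where i0: "i0 \<in> I" "g j i0 \<noteq> 0" by auto
    \<comment> \<open>Equation \<open>k\<close> after \<open>i0\<close> has been eliminated with the
      help of equation \<open>j\<close>; below, \<open>v'\<close> gets at \<open>i0\<close> the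
      value that solves equation \<open>j\<close>.\<close>
    define g' where "g' k i = g k i - g k i0 * g j i / g j i0" for k i
    have "card J < card (I - {i0})" using insert i0 by simp
    from insert.IH[OF _ this, of g'] insert.prems obtain v where
      v: "\<exists>i\<in>I - {i0}. v i \<noteq> 0" "\<And>k. k \<in> J \<Longrightarrow> (\<Sum>i\<in>I - {i0}. g' k i * v i) = 0"
      by auto
    define s where "s = (\<Sum>i\<in>I - {i0}. g j i * v i)"
    define v' where "v' = v(i0 := - s / g j i0)"
    have split: "(\<Sum>i\<in>I. g k i * v' i) = - g k i0 * s / g j i0 + (\<Sum>i\<in>I - {i0}. g k i * v i)" for k
      using i0 insert.prems by (simp add: sum.remove[of I i0] v'_def)
    have "(\<Sum>i\<in>I. g k i * v' i) = 0" if "k \<in> insert j J" for k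
    proof (cases "k = j")
      case True
      then show ?thesis using i0 by (simp add: split flip: s_def)
    next
      case False
      then have "0 = (\<Sum>i\<in>I - {i0}. g k i * v i - g k i0 / g j i0 * (g j i * v i))"
        using v(2)[of k] that by (simp add: g'_def algebra_simps)
      also have "\<dots> = (\<Sum>i\<in>I - {i0}. g k i * v i) - g k i0 / g j i0 * s"
        by (simp add: sum_subtractf s_def sum_distrib_left)
      finally show ?thesis by (simp add: split)
    qed
    moreover have "\<exists>i\<in>I. v' i \<noteq> 0" using v(1) by (auto simp: v'_def)
    ultimately show ?thesis by blast
  qed
qed

lemma det_eq_0_of_kernel:
  fixes A :: "'k::field mat"
  assumes A: "A \<in> carrier_mat n n" and v: "i < n" "v i \<noteq> 0"
    and ker: "\<And>i. i < n \<Longrightarrow> (\<Sum>j<n. A $$ (i, j) * v j) = 0"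
  shows "det A = 0"
proof -
  have "A *\<^sub>v vec n v = 0\<^sub>v n"
    using A ker by (auto simp: scalar_prod_def lessThan_atLeast0)
  moreover have "vec n v \<noteq> 0\<^sub>v n"
    using v by (metis index_vec index_zero_vec(1))
  ultimately show ?thesis
    using det_0_iff_vec_prod_zero_field[OF A] vec_carrier by blast
qed

lemma self_in_proj_point: "u \<in> proj_point u"
  by (simp add: proj_point_def cvec.span_base)

text \<open>Rank at most \<open>q\<close> at \<open>x\<close> is encoded by at most \<open>q\<close>
  functionals \<open>g x k\<close> whose common zeros lie in the kernel. If \<open>card I\<close>
  exceeded \<open>r * q\<close>, then for any \<open>r\<close> points some nonzero vector would be
  killed by all their matrices, hence by those of the whole span. The determinant would vanish on
  the secant variety, although at \<open>P\<close> it is a product of nonzero diagonal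
  entries.\<close>

lemma secant_variety_flattening_bound:
  fixes E :: "'b \<Rightarrow> 'b \<Rightarrow> 'a poly_C"
    and J :: "('a \<Rightarrow>\<^sub>0 complex) \<Rightarrow> 'c set"
  assumes I: "finite I"
    and hom: "\<And>i j. i \<in> I \<Longrightarrow> j \<in> I \<Longrightarrow> homogeneous 1 (E i j)"
    and J: "\<And>x. x \<in> S - {0} \<Longrightarrow> finite (J x) \<and> card (J x) \<le> q"
    and ker: "\<And>x v i. x \<in> S - {0} \<Longrightarrow> (\<And>k. k \<in> J x \<Longrightarrow> (\<Sum>j\<in>I. g x k j * v j) = 0)
      \<Longrightarrow> i \<in> I \<Longrightarrow> (\<Sum>j\<in>I. peval (E i j) (Poly_Mapping.lookup x) * v j) = 0"
    and diag: "\<And>i. i \<in> I \<Longrightarrow> peval (E i i) (Poly_Mapping.lookup P) \<noteq> 0"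
    and offdiag: "\<And>i j. i \<in> I \<Longrightarrow> j \<in> I \<Longrightarrow> i \<noteq> j \<Longrightarrow> peval (E i j) (Poly_Mapping.lookup P) = 0"
    and P: "P \<noteq> 0" "proj_point P \<in> secant_variety U r (proj S)"
  shows "card I \<le> r * q"
proof (rule ccontr)
  assume "\<not> card I \<le> r * q"
  then have less: "r * q < card I" by simp
  define R where "R = card I"
  obtain f where f: "bij_betw f {0..<R} I"
    using ex_bij_betw_nat_finite[OF I] unfolding R_def by blast
  then have f_in: "f i \<in> I" if "i < R" for i
    using that by (auto simp: bij_betw_def)
  have f_eq: "f i = f j \<longleftrightarrow> i = j" if "i < R" "j < R" for i j
    using that f by (auto simp: bij_betw_def inj_on_def)
  define A where "A = mat R R (\<lambda>(i, j). E (f i) (f j))"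
  define ev where "ev u = map_mat (\<lambda>F. peval F (Poly_Mapping.lookup u)) A" for u
  have A: "A \<in> carrier_mat R R" and ev_A: "ev u \<in> carrier_mat R R" for u
    by (auto simp: A_def ev_def)
  have peval_det: "peval (det A) (Poly_Mapping.lookup u) = det (ev u)" for u
    unfolding ev_def by (rule peval.hom_det[symmetric])
  have hom_det: "homogeneous R (det A)"
    by (rule homogeneous_det[OF A]) (simp add: A_def hom[unfolded One_nat_def] f_in)
  have "vanishes_at (det A) p"
    if len: "length ps = r" and "set ps \<subseteq> proj S" and p: "p \<in> proj_span (set ps)" for ps p
  proof -
    have "\<forall>k<r. \<exists>z. z \<in> S - {0} \<and> ps ! k = proj_point z"
      using that by (auto simp: proj_def set_conv_nth)
    then obtain z where z: "\<And>k. k < r \<Longrightarrow> z k \<in> S - {0}" "\<And>k. k < r \<Longrightarrow> ps ! k = proj_point (z k)"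
      by metis
    define JJ where "JJ = (SIGMA k:{..<r}. J (z k))"
    have "card JJ = (\<Sum>k<r. card (J (z k)))"
      unfolding JJ_def using z J by (intro card_SigmaI) auto
    also have "\<dots> \<le> (\<Sum>k<r. q)"
      using z J by (intro sum_mono) auto
    finally have "card JJ < card I" using less by simp
    moreover have "finite JJ" unfolding JJ_def using z J by auto
    ultimately obtain v where v: "\<exists>i\<in>I. v i \<noteq> 0"
      "\<And>k j. (k, j) \<in> JJ \<Longrightarrow> (\<Sum>i\<in>I. g (z k) j i * v i) = 0"
      using homogeneous_linear_system_nontrivial[of JJ I "\<lambda>(k, j) i. g (z k) j i"] I by fastforce
    \<comment> \<open>The points whose matrix kills the fixed vector \<open>v\<close> form a
      subspace, because the entries are linear forms.\<close>
    define K where "K = {u. \<forall>i\<in>I. (\<Sum>j\<in>I. peval (E i j) (Poly_Mapping.lookup u) * v j) = 0}"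
    have K: "cvec.subspace K"
      unfolding cvec.subspace_def
    proof (intro conjI ballI allI)
      show "0 \<in> K"
        using peval_homogeneous_1_scale[OF hom, of _ _ 0 "\<lambda>_. 0"]
        by (simp add: K_def zero_poly_mapping.rep_eq)
    next
      fix x y assume "x \<in> K" "y \<in> K"
      then show "x + y \<in> K"
        by (simp add: K_def plus_poly_mapping.rep_eq peval_homogeneous_1_add[OF hom]
            algebra_simps sum.distrib)
    next
      fix c x assume "x \<in> K"
      then show "cscale c x \<in> K"
        by (simp add: K_def peval_homogeneous_1_scale[OF hom] lookup_cscale[abs_def] mult.assoc
            flip: sum_distrib_left)
    qed
    have zK: "z k \<in> K" if "k < r" for k
      using ker[OF z(1)[OF that], of v] v(2) that by (auto simp: K_def JJ_def)
    have "\<Union>(set ps) \<subseteq> K"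
    proof
      fix x assume "x \<in> \<Union>(set ps)"
      then obtain k where "k < r" "x \<in> proj_point (z k)"
        using z(2) len by (metis UnionE in_set_conv_nth)
      then show "x \<in> K"
        using cvec.span_minimal[of "{z k}" K] zK K unfolding proj_point_def by auto
    qed
    then have span: "cvec.span (\<Union>(set ps)) \<subseteq> K"
      by (rule cvec.span_minimal[OF _ K])
    have det0: "det (ev u) = 0" if "u \<in> K" for u
    proof -
      obtain i0 where i0: "i0 < R" "v (f i0) \<noteq> 0"
        using v(1) f by (auto simp: bij_betw_def)
      have "(\<Sum>j<R. ev u $$ (i, j) * v (f j)) = 0" if "i < R" for i
      proof -
        have "(\<Sum>j<R. ev u $$ (i, j) * v (f j)) =
            (\<Sum>j\<in>{0..<R}. peval (E (f i) (f j)) (Poly_Mapping.lookup u) * v (f j))"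
          using that by (simp add: ev_def A_def lessThan_atLeast0)
        also have "\<dots> = (\<Sum>j\<in>I. peval (E (f i) j) (Poly_Mapping.lookup u) * v j)"
          by (rule sum.reindex_bij_betw[OF f])
        also have "\<dots> = 0" using \<open>u \<in> K\<close> f_in[OF that] by (simp add: K_def)
        finally show ?thesis .
      qed
      then show ?thesis
        using i0 by (intro det_eq_0_of_kernel[OF ev_A, of i0 "\<lambda>i. v (f i)"]) auto
    qed
    obtain u0 where u0: "u0 \<in> cvec.span (\<Union>(set ps))" "p = proj_point u0"
      using p by (auto simp: proj_span_def proj_def)
    then have "p \<subseteq> K"
      using cvec.span_minimal[of "{u0}" K] span K unfolding proj_point_def by blast
    then show ?thesis
      unfolding vanishes_at_def peval_det using det0 by blast
  qed
  then have "vanishes_at (det A) (proj_point P)"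
    using P(2) hom_det unfolding secant_variety_def zariski_closure_def by blast
  then have "det (ev P) = 0"
    using P(1) self_in_proj_point[of P] unfolding vanishes_at_def peval_det by blast
  \<comment> \<open>At \<open>P\<close> the matrix is diagonal, in particular upper
    triangular.\<close>
  moreover have "det (ev P) = prod_list (diag_mat (ev P))"
    by (rule det_upper_triangular[OF _ ev_A])
       (auto simp: ev_def A_def upper_triangular_def f_in f_eq intro!: offdiag)
  moreover have "\<dots> \<noteq> 0"
    by (auto simp: prod_list_zero_iff diag_mat_def ev_def A_def diag f_in)
  ultimately show False by simp
qed

section \<open>Powers of linear forms\<close>

text \<open>The denominator of the multinomial coefficient.\<close>

definition mfact :: "('i \<Rightarrow>\<^sub>0 nat) \<Rightarrow> complex" where
  "mfact m = (\<Prod>i\<in>Poly_Mapping.keys m. fact (Poly_Mapping.lookup m i))"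

lemma mfact_superset:
  assumes "finite S" "Poly_Mapping.keys m \<subseteq> S"
  shows "mfact m = (\<Prod>i\<in>S. fact (Poly_Mapping.lookup m i))"
  unfolding mfact_def using assms by (intro prod.mono_neutral_left) (auto simp: in_keys_iff)

lemma mfact_nonzero [simp]: "mfact m \<noteq> 0"
  by (simp add: mfact_def)

lemma mfact_0 [simp]: "mfact 0 = 1"
  by (simp add: mfact_def)

lemma mfact_add_single:
  "mfact (Poly_Mapping.single i 1 + m) = of_nat (Suc (Poly_Mapping.lookup m i)) * mfact m"
proof -
  let ?S = "insert i (Poly_Mapping.keys m)"
  have "Poly_Mapping.keys (Poly_Mapping.single i 1 + m) \<subseteq> ?S"
    using Poly_Mapping.keys_add[of "Poly_Mapping.single i 1" m] by auto
  then have "mfact (Poly_Mapping.single i 1 + m) =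
      (\<Prod>j\<in>?S. fact (Poly_Mapping.lookup (Poly_Mapping.single i 1 + m) j))"
    by (intro mfact_superset) auto
  also have "\<dots> = fact (Suc (Poly_Mapping.lookup m i)) *
      (\<Prod>j\<in>?S - {i}. fact (Poly_Mapping.lookup m j))"
    by (subst prod.remove[of _ i])
       (auto simp: Poly_Mapping.lookup_add Poly_Mapping.lookup_single when_def simp del: fact_Suc
         split: if_splits intro!: prod.cong)
  also have "\<dots> = of_nat (Suc (Poly_Mapping.lookup m i)) *
      (\<Prod>j\<in>?S. fact (Poly_Mapping.lookup m j))"
    by (subst prod.remove[of ?S i]) (auto simp: mult.assoc)
  also have "(\<Prod>j\<in>?S. fact (Poly_Mapping.lookup m j)) = mfact m"
    by (rule mfact_superset[symmetric]) auto
  finally show ?thesis .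
qed

text \<open>Subtraction of exponents truncates at 0, so monomials not divisible by the variable form
  a separate case.\<close>

lemma lookup_single_mult:
  fixes G :: "'i poly_C"
  shows "Poly_Mapping.lookup (Poly_Mapping.single (Poly_Mapping.single i 1) c * G) m =
    (if Poly_Mapping.lookup m i = 0 then 0
     else c * Poly_Mapping.lookup G (m - Poly_Mapping.single i 1))"
proof -
  let ?e = "Poly_Mapping.single i (1::nat)"
  have eq: "?e + m' = m \<longleftrightarrow> Poly_Mapping.lookup m i \<noteq> 0 \<and> m' = m - ?e" for m'
  proof
    assume "?e + m' = m"
    then show "Poly_Mapping.lookup m i \<noteq> 0 \<and> m' = m - ?e"
      by (auto simp: Poly_Mapping.lookup_add)
  next
    assume "Poly_Mapping.lookup m i \<noteq> 0 \<and> m' = m - ?e"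
    then show "?e + m' = m"
      by (auto intro!: poly_mapping_eqI
          simp: Poly_Mapping.lookup_add Poly_Mapping.lookup_minus Poly_Mapping.lookup_single when_def)
  qed
  have "Poly_Mapping.single ?e c * G =
      (\<Sum>m'\<in>Poly_Mapping.keys G. Poly_Mapping.single (?e + m') (c * Poly_Mapping.lookup G m'))"
    by (subst poly_mapping_eq_sum_single[of G])
       (simp add: sum_distrib_left Poly_Mapping.mult_single)
  then have "Poly_Mapping.lookup (Poly_Mapping.single ?e c * G) m =
      (\<Sum>m'\<in>Poly_Mapping.keys G. if ?e + m' = m then c * Poly_Mapping.lookup G m' else 0)"
    by (simp add: Poly_Mapping.lookup_sum Poly_Mapping.lookup_single when_def)
  also have "\<dots> = (if Poly_Mapping.lookup m i = 0 then 0 else c * Poly_Mapping.lookup G (m - ?e))"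
    unfolding eq by (auto simp: in_keys_iff sum.neutral)
  finally show ?thesis .
qed

definition linear_form :: "'i set \<Rightarrow> ('i \<Rightarrow> complex) \<Rightarrow> 'i poly_C" where
  "linear_form I a = (\<Sum>i\<in>I. Poly_Mapping.single (Poly_Mapping.single i 1) (a i))"

lemma mdegree_eq_0D: "mdegree m = 0 \<Longrightarrow> m = 0"
  by (auto simp: mdegree_def in_keys_iff intro!: poly_mapping_eqI)

text \<open>The multinomial theorem without division. Splitting off one factor of the power gives,
  for each \<open>i\<close>, a term weighted by the exponent of \<open>i\<close> in
  \<open>m\<close>; these weights add up to the degree, which turns \<open>fact d\<close> into
  \<open>fact (Suc d)\<close>.\<close>

lemma lookup_linear_form_power:
  assumes I: "finite I" and m: "Poly_Mapping.keys m \<subseteq> I" "mdegree m = d"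
  shows "mfact m * Poly_Mapping.lookup (linear_form I a ^ d) m = fact d * meval a m"
  using m
proof (induction d arbitrary: m)
  case 0
  then have "m = 0" by (simp add: mdegree_eq_0D)
  then show ?case by simp
next
  case (Suc d)
  let ?e = "\<lambda>i. Poly_Mapping.single i (1::nat)"
  \<comment> \<open>Lowering the exponent of \<open>i\<close> by one divides \<open>mfact m\<close>
    by that exponent; if the exponent is 0, both sides vanish.\<close>
  have step: "mfact m * Poly_Mapping.lookup
        (Poly_Mapping.single (?e i) (a i) * linear_form I a ^ d) m =
      of_nat (Poly_Mapping.lookup m i) * (fact d * meval a m)" if i: "i \<in> I" for i
  proof (cases "Poly_Mapping.lookup m i = 0")
    case True
    then show ?thesis by (simp add: lookup_single_mult[unfolded One_nat_def])
  next
    case False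
    define m' where "m' = m - ?e i"
    have m: "m = ?e i + m'"
      using False by (auto intro!: poly_mapping_eqI
          simp: m'_def Poly_Mapping.lookup_add Poly_Mapping.lookup_minus Poly_Mapping.lookup_single when_def)
    have eqs: "Poly_Mapping.lookup m i = Suc (Poly_Mapping.lookup m' i)" "meval a m = a i * meval a m'"
      by (subst m; simp add: Poly_Mapping.lookup_add meval_add)+
    have "Poly_Mapping.keys m' \<subseteq> I"
      using Suc.prems(1) by (auto simp: m'_def in_keys_iff Poly_Mapping.lookup_minus)
    moreover have "mdegree m' = d"
      using Suc.prems(2) unfolding m mdegree_add by simp
    ultimately have IH: "mfact m' * Poly_Mapping.lookup (linear_form I a ^ d) m' = fact d * meval a m'"
      by (rule Suc.IH)
    have "mfact m * Poly_Mapping.lookup (Poly_Mapping.single (?e i) (a i) * linear_form I a ^ d) m =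
        of_nat (Suc (Poly_Mapping.lookup m' i)) * a i *
          (mfact m' * Poly_Mapping.lookup (linear_form I a ^ d) m')"
      unfolding lookup_single_mult m'_def[symmetric] using False
      by (subst m, subst mfact_add_single) (simp add: mult_ac)
    also have "\<dots> = of_nat (Poly_Mapping.lookup m i) * (fact d * meval a m)"
      unfolding IH eqs by (simp add: mult_ac)
    finally show ?thesis .
  qed
  have "linear_form I a ^ Suc d =
      (\<Sum>i\<in>I. Poly_Mapping.single (?e i) (a i) * linear_form I a ^ d)"
    by (simp add: linear_form_def sum_distrib_right)
  then have "mfact m * Poly_Mapping.lookup (linear_form I a ^ Suc d) m =
      (\<Sum>i\<in>I. of_nat (Poly_Mapping.lookup m i) * (fact d * meval a m))"
    by (simp add: Poly_Mapping.lookup_sum sum_distrib_left step[unfolded One_nat_def])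
  also have "\<dots> = of_nat (mdegree m) * (fact d * meval a m)"
    by (simp add: mdegree_superset[OF I Suc.prems(1)] sum_distrib_right)
  finally show ?case using Suc.prems by (simp add: mult_ac)
qed

lemma sym_power_1E:
  assumes "w \<in> sym_power 1 I" "finite I"
  shows "w = linear_form I (\<lambda>i. Poly_Mapping.lookup w (Poly_Mapping.single i 1))"
proof (rule poly_mapping_eqI)
  fix m
  let ?L = "linear_form I (\<lambda>i. Poly_Mapping.lookup w (Poly_Mapping.single i 1))"
  have L: "Poly_Mapping.lookup ?L m =
      (\<Sum>i\<in>I. if Poly_Mapping.single i 1 = m then Poly_Mapping.lookup w m else 0)"
    by (auto simp: linear_form_def Poly_Mapping.lookup_sum Poly_Mapping.lookup_single when_def
        intro!: sum.cong)
  show "Poly_Mapping.lookup w m = Poly_Mapping.lookup ?L m"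
  proof (cases "\<exists>i\<in>I. m = Poly_Mapping.single i 1")
    case True
    then obtain i where i: "i \<in> I" "m = Poly_Mapping.single i 1" by blast
    have "Poly_Mapping.single j (1::nat) = m \<longleftrightarrow> j = i" for j
      using i by (metis keys_single one_neq_zero singleton_inject)
    then show ?thesis unfolding L using i assms(2) by simp
  next
    case False
    have "m \<notin> Poly_Mapping.keys w"
    proof
      assume m: "m \<in> Poly_Mapping.keys w"
      then have "mdegree m = 1"
        using assms(1) by (simp add: sym_power_def homogeneous_def)
      then obtain i where i: "m = Poly_Mapping.single i 1"
        by (rule mdegree_eq_1E)
      then have "i \<in> I"
        using assms(1) m by (force simp: sym_power_def)
      with i False show False by blast
    qed
    then show ?thesis unfolding L using False by (auto simp: in_keys_iff sum.neutral)
  qed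
qed

lemma sym_power_mult: "F \<in> sym_power k I \<Longrightarrow> G \<in> sym_power l I \<Longrightarrow> F * G \<in> sym_power (k + l) I"
  unfolding sym_power_def
proof (intro CollectI conjI ballI; elim CollectE conjE)
  fix m
  assume keys: "\<forall>m\<in>Poly_Mapping.keys F. Poly_Mapping.keys m \<subseteq> I"
    "\<forall>m\<in>Poly_Mapping.keys G. Poly_Mapping.keys m \<subseteq> I" and "m \<in> Poly_Mapping.keys (F * G)"
  then obtain a b where "m = a + b" "a \<in> Poly_Mapping.keys F" "b \<in> Poly_Mapping.keys G"
    using Poly_Mapping.keys_mult[of F G] by blast
  then show "Poly_Mapping.keys m \<subseteq> I"
    using keys Poly_Mapping.keys_add[of a b] by blast
qed (rule homogeneous_mult)

lemma one_in_sym_power [simp]: "1 \<in> sym_power 0 I"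
  by (simp add: sym_power_def flip: Poly_Mapping.single_one)

lemma sym_power_power: "F \<in> sym_power k I \<Longrightarrow> F ^ d \<in> sym_power (d * k) I"
  by (induction d) (auto intro: sym_power_mult)

lemma sym_power_add: "F \<in> sym_power k I \<Longrightarrow> G \<in> sym_power k I \<Longrightarrow> F + G \<in> sym_power k I"
  using Poly_Mapping.keys_add[of F G] by (fastforce simp: sym_power_def homogeneous_add)

lemma zero_in_sym_power [simp]: "0 \<in> sym_power k I"
  by (simp add: sym_power_def)

lemma sym_power_sum: "(\<And>i. i \<in> S \<Longrightarrow> f i \<in> sym_power k I) \<Longrightarrow> sum f S \<in> sym_power k I"
  by (induction S rule: infinite_finite_induct) (auto simp: sym_power_add)

lemma linear_form_in_sym_power: "S \<subseteq> I \<Longrightarrow> linear_form S a \<in> sym_power 1 I"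
  unfolding linear_form_def by (intro sym_power_sum) (auto simp: sym_power_def)

lemma linear_form_power_in_sym_power: "S \<subseteq> I \<Longrightarrow> linear_form S a ^ d \<in> sym_power d I"
  using sym_power_power[OF linear_form_in_sym_power, of S I a d] by simp

section \<open>Squarefree monomials and polarization\<close>

definition sqfree :: "'i set \<Rightarrow> 'i \<Rightarrow>\<^sub>0 nat" where
  "sqfree A = (\<Sum>i\<in>A. Poly_Mapping.single i 1)"

lemma lookup_sqfree:
  "finite A \<Longrightarrow> Poly_Mapping.lookup (sqfree A) j = (if j \<in> A then 1 else 0)"
  by (simp add: sqfree_def Poly_Mapping.lookup_sum Poly_Mapping.lookup_single when_def)

lemma keys_sqfree: "finite A \<Longrightarrow> Poly_Mapping.keys (sqfree A) = A"
  by (auto simp: in_keys_iff lookup_sqfree split: if_splits)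

lemma mdegree_sqfree: "finite A \<Longrightarrow> mdegree (sqfree A) = card A"
  by (simp add: mdegree_def keys_sqfree lookup_sqfree)

lemma meval_sqfree: "finite A \<Longrightarrow> meval a (sqfree A) = (\<Prod>i\<in>A. a i)"
  by (simp add: meval_def keys_sqfree lookup_sqfree)

lemma mfact_sqfree: "finite A \<Longrightarrow> mfact (sqfree A) = 1"
  by (simp add: mfact_def keys_sqfree lookup_sqfree)

lemma prod_Var: "(\<Prod>i\<in>A. Var i) = Poly_Mapping.single (sqfree A) 1"
  by (induction A rule: infinite_finite_induct)
     (auto simp: sqfree_def Var_def Poly_Mapping.mult_single)

lemma prod_Var_nonzero: "(\<Prod>i\<in>A. Var i) \<noteq> 0"
  unfolding prod_Var by (metis Poly_Mapping.lookup_single_eq Poly_Mapping.lookup_zero zero_neq_one)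

text \<open>\<open>card I\<close> exponents that are all at least 1 and sum to \<open>card I\<close>
  leave no room for an exponent above 1.\<close>

lemma eq_sqfree_of_full_keys:
  assumes "finite I" "Poly_Mapping.keys m = I" "mdegree m = card I"
  shows "m = sqfree I"
proof (rule poly_mapping_eqI)
  have "(\<Sum>i\<in>I. Poly_Mapping.lookup m i - 1) = (\<Sum>i\<in>I. Poly_Mapping.lookup m i) - (\<Sum>i\<in>I. 1)"
    using assms(2) by (intro sum_subtractf_nat) (auto simp: in_keys_iff Suc_le_eq)
  also have "\<dots> = 0"
    using assms by (simp add: mdegree_def)
  finally have "\<forall>i\<in>I. Poly_Mapping.lookup m i - 1 = 0"
    using assms(1) by simp
  then show "Poly_Mapping.lookup m k = Poly_Mapping.lookup (sqfree I) k" for k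
    using assms(1,2) by (cases "k \<in> I") (auto simp: lookup_sqfree in_keys_iff le_Suc_eq)
qed

text \<open>Inclusion-exclusion: the power over \<open>S\<close> contains a monomial only if all its
  variables lie in \<open>S\<close>, and the alternating sum over such \<open>S\<close> cancels
  unless every variable of \<open>I\<close> occurs.\<close>

lemma polarization:
  fixes I :: "'i set"
  assumes I: "finite I"
  shows "cscale (fact (card I)) (\<Prod>i\<in>I. Var i) =
    (\<Sum>S\<in>Pow I. cscale ((- 1) ^ card (I - S)) (linear_form S (\<lambda>_. 1) ^ card I))"
    (is "?L = ?R")
proof (rule poly_mapping_eqI)
  fix m
  let ?N = "card I"
  have R: "Poly_Mapping.lookup ?R m =
      (\<Sum>S\<in>Pow I. (- 1) ^ card (I - S) * Poly_Mapping.lookup (linear_form S (\<lambda>_. 1) ^ ?N) m)"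
    by (simp add: Poly_Mapping.lookup_sum)
  have L: "Poly_Mapping.lookup ?L m = (if m = sqfree I then fact ?N else 0)"
    by (simp add: prod_Var Poly_Mapping.lookup_single when_def)
  show "Poly_Mapping.lookup ?L m = Poly_Mapping.lookup ?R m"
  proof (cases "Poly_Mapping.keys m \<subseteq> I \<and> mdegree m = ?N")
    case False
    have "Poly_Mapping.lookup (linear_form S (\<lambda>_. 1) ^ ?N) m = 0" if "S \<in> Pow I" for S
      using linear_form_power_in_sym_power[of S I "\<lambda>_. 1" ?N] that False
      by (auto simp: sym_power_def homogeneous_def in_keys_iff)
    then have "Poly_Mapping.lookup ?R m = 0" unfolding R by simp
    moreover have "m \<noteq> sqfree I"
      using False I by (auto simp: keys_sqfree mdegree_sqfree)
    ultimately show ?thesis unfolding L by simp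
  next
    case True
    let ?K = "Poly_Mapping.keys m"
    have lf: "mfact m * Poly_Mapping.lookup (linear_form S (\<lambda>_. 1) ^ ?N) m =
        fact ?N * (if ?K \<subseteq> S then 1 else 0)" if "S \<in> Pow I" for S
    proof -
      have "linear_form S (\<lambda>_. 1) = linear_form I (\<lambda>i. if i \<in> S then 1 else 0)"
        unfolding linear_form_def using that I by (intro sum.mono_neutral_cong_left) auto
      then have "mfact m * Poly_Mapping.lookup (linear_form S (\<lambda>_. 1) ^ ?N) m =
          fact ?N * meval (\<lambda>i. if i \<in> S then 1 else 0) m"
        using lookup_linear_form_power[OF I, of m ?N] True by simp
      also have "meval (\<lambda>i. if i \<in> S then 1 else 0) m = (if ?K \<subseteq> S then 1 else 0)"
        by (auto simp: meval_def in_keys_iff intro!: prod.neutral)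
      finally show ?thesis .
    qed
    have "mfact m * Poly_Mapping.lookup ?R m =
        fact ?N * (\<Sum>S\<in>Pow I. (- 1) ^ card (I - S) * (if ?K \<subseteq> S then 1 else 0))"
      unfolding R sum_distrib_left
    proof (rule sum.cong[OF refl])
      fix S assume "S \<in> Pow I"
      from lf[OF this] show "mfact m * ((- 1) ^ card (I - S) *
          Poly_Mapping.lookup (linear_form S (\<lambda>_. 1) ^ ?N) m) =
        fact ?N * ((- 1) ^ card (I - S) * (if ?K \<subseteq> S then 1 else 0))"
        by (simp add: mult.left_commute)
    qed
    \<comment> \<open>Writing the sign and the containment as one product over \<open>I - S\<close>
      makes the sum the expansion of a product over \<open>I\<close>, in which a variable missing
      from \<open>m\<close> gives the factor 0.\<close>
    also have "(\<Sum>S\<in>Pow I. (- 1) ^ card (I - S) * (if ?K \<subseteq> S then 1 else (0::complex))) =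
        (\<Sum>S\<in>Pow I. (\<Prod>i\<in>S. 1) * (\<Prod>i\<in>I - S. if i \<in> ?K then 0 else - 1))"
    proof (rule sum.cong[OF refl])
      fix S assume S: "S \<in> Pow I"
      show "(- 1) ^ card (I - S) * (if ?K \<subseteq> S then 1 else (0::complex)) =
        (\<Prod>i\<in>S. 1) * (\<Prod>i\<in>I - S. if i \<in> ?K then 0 else - 1)"
      proof (cases "?K \<subseteq> S")
        case True
        then have "(\<Prod>i\<in>I - S. if i \<in> ?K then 0 else - 1 :: complex) = (\<Prod>i\<in>I - S. - 1)"
          by (intro prod.cong) auto
        then show ?thesis using True by simp
      next
        case False
        then show ?thesis using \<open>?K \<subseteq> I \<and> mdegree m = ?N\<close> I by (auto simp: prod_zero_iff)
      qed
    qed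
    also have "\<dots> = (\<Prod>i\<in>I. 1 + (if i \<in> ?K then 0 else - 1))"
      by (rule prod_add[OF I, symmetric])
    also have "\<dots> = (if m = sqfree I then 1 else 0)"
      using True I eq_sqfree_of_full_keys[OF I] by (auto simp: keys_sqfree)
    finally have "mfact m * Poly_Mapping.lookup ?R m = mfact m * Poly_Mapping.lookup ?L m"
      unfolding L using I by (auto simp: mfact_sqfree)
    then show ?thesis by simp
  qed
qed

lemma proj_point_in_secant_variety:
  assumes "P \<in> U" "P \<noteq> 0" "set ps \<subseteq> X" "P \<in> cvec.span (\<Union>(set ps))"
  shows "proj_point P \<in> secant_variety U (length ps) X"
  using assms unfolding secant_variety_def zariski_closure_def proj_span_def proj_def by auto

text \<open>Ensures that the \<open>LEAST\<close> in \<open>sym_border_rank\<close> is attained: by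
  polarization the monomial lies in the span of powers indexed by the subsets of
  \<open>I\<close>.\<close>

lemma monomial_in_some_secant_variety:
  assumes I: "finite I"
  shows "\<exists>r. proj_point (\<Prod>i\<in>I. Var i) \<in>
    secant_variety (sym_power (card I) I) r (veronese (card I) I)"
proof -
  let ?N = "card I"
  let ?P = "\<Prod>i\<in>I. Var i"
  define W where "W = (\<lambda>S. linear_form S (\<lambda>_. 1) ^ ?N) ` Pow I"
  have "finite (proj W)" using I by (simp add: W_def proj_def)
  then obtain ps where ps: "set ps = proj W" using finite_list by blast
  have W_span: "W \<subseteq> cvec.span (\<Union>(set ps))"
  proof
    fix x assume "x \<in> W"
    \<comment> \<open>The zero vector, which comes from \<open>S = {}\<close> if \<open>I\<close> is
      nonempty, has no projective point but lies in every span.\<close>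
    then show "x \<in> cvec.span (\<Union>(set ps))"
      using self_in_proj_point[of x] unfolding ps proj_def
      by (cases "x = 0") (auto intro: cvec.span_zero cvec.span_base)
  qed
  have "?P = cscale (1 / fact ?N) (cscale (fact ?N) ?P)"
    by (simp add: cvec.scale_scale)
  also have "\<dots> \<in> cvec.span (\<Union>(set ps))"
    unfolding polarization[OF I] using W_span
    by (intro cvec.span_scale cvec.span_sum) (auto simp: W_def)
  finally have "?P \<in> cvec.span (\<Union>(set ps))" .
  moreover have "set ps \<subseteq> veronese ?N I"
  proof -
    have "W \<subseteq> {z \<in> sym_power ?N I. \<exists>w\<in>sym_power 1 I. z = w ^ ?N}"
      using linear_form_power_in_sym_power linear_form_in_sym_power unfolding W_def by blast
    then show ?thesis unfolding ps veronese_def proj_def by blast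
  qed
  moreover have "?P \<in> sym_power ?N I"
    using I by (simp add: prod_Var sym_power_def mdegree_sqfree keys_sqfree)
  moreover have "?P \<noteq> 0"
    by (rule prod_Var_nonzero)
  ultimately show ?thesis
    using proj_point_in_secant_variety by blast
qed

section \<open>The Koszul flattening of the monomial\<close>

text \<open>The sign from sorting the basis vector of \<open>j\<close> past the smaller ones in its
  wedge product with that of \<open>B\<close>.\<close>

definition ext_sign :: "'i::linorder \<Rightarrow> 'i set \<Rightarrow> complex" where
  "ext_sign j B = (- 1) ^ card {b \<in> B. b < j}"

lemma ext_sign_nonzero [simp]: "ext_sign j B \<noteq> 0"
  by (simp add: ext_sign_def)

text \<open>The source of anticommutativity: when two distinct elements are inserted in turn, the
  two orders give opposite signs, since exactly one element lies below the other.\<close>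

lemma ext_sign_insert:
  assumes "finite B" "k \<notin> B"
  shows "ext_sign j (insert k B) = (if k < j then - ext_sign j B else ext_sign j B)"
proof -
  have "{b \<in> insert k B. b < j} = (if k < j then insert k {b \<in> B. b < j} else {b \<in> B. b < j})"
    by auto
  then show ?thesis using assms by (simp add: ext_sign_def)
qed

text \<open>The matrix of the exterior multiplication by \<open>\<Sum>j\<in>I. a j * e j\<close>.\<close>

definition wedge_coeff :: "'i::linorder set \<Rightarrow> ('i \<Rightarrow> complex) \<Rightarrow> 'i set \<Rightarrow> 'i set \<Rightarrow> complex" where
  "wedge_coeff I a D B = (\<Sum>j\<in>I. if j \<notin> B \<and> D = insert j B then ext_sign j B * a j else 0)"

text \<open>The identity \<open>a \<and> a \<and> y = 0\<close> in coordinates: the two orders of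
  adding two elements to \<open>B\<close> cancel.\<close>

lemma wedge_wedge_eq_0:
  assumes I: "finite I" and G: "G \<subseteq> I" and B: "B \<subseteq> I"
  shows "(\<Sum>j\<in>G. ext_sign j (G - {j}) * a j * wedge_coeff I a (G - {j}) B) = 0"
proof -
  \<comment> \<open>The contribution of adding first \<open>k\<close> and then
    \<open>j\<close>.\<close>
  define t where "t j k = (if j \<noteq> k \<and> j \<notin> B \<and> k \<notin> B \<and> G = insert j (insert k B)
    then ext_sign j (insert k B) * ext_sign k B * a j * a k else 0)" for j k
  have "finite B" "finite G" using I G B finite_subset by auto
  have anti: "t j k = - t k j" for j k
    using \<open>finite B\<close> by (auto simp: t_def ext_sign_insert insert_commute)
  have "ext_sign j (G - {j}) * a j * wedge_coeff I a (G - {j}) B = (\<Sum>k\<in>G. t j k)" if "j \<in> G" for j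
  proof -
    have "ext_sign j (G - {j}) * a j * (if k \<notin> B \<and> G - {j} = insert k B then ext_sign k B * a k else 0)
        = t j k" for k
    proof (cases "k \<notin> B \<and> G - {j} = insert k B")
      case True
      then have "j \<noteq> k \<and> j \<notin> B \<and> k \<notin> B \<and> G = insert j (insert k B)"
        using that by auto
      then show ?thesis using True by (simp add: t_def)
    next
      case False
      then have "\<not> (j \<noteq> k \<and> j \<notin> B \<and> k \<notin> B \<and> G = insert j (insert k B))"
        by auto
      then show ?thesis using False by (simp only: t_def if_False mult_zero_right)
    qed
    then have "ext_sign j (G - {j}) * a j * wedge_coeff I a (G - {j}) B = (\<Sum>k\<in>I. t j k)"
      by (simp only: wedge_coeff_def sum_distrib_left)
    also have "\<dots> = (\<Sum>k\<in>G. t j k)"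
      using I G by (intro sum.mono_neutral_right) (auto simp: t_def)
    finally show ?thesis .
  qed
  then have eq: "(\<Sum>j\<in>G. ext_sign j (G - {j}) * a j * wedge_coeff I a (G - {j}) B) =
      (\<Sum>j\<in>G. \<Sum>k\<in>G. t j k)"
    by (rule sum.cong[OF refl])
  have "(\<Sum>j\<in>G. \<Sum>k\<in>G. t j k) = (\<Sum>j\<in>G. \<Sum>k\<in>G. - t k j)"
    by (intro sum.cong refl anti)
  also have "\<dots> = - (\<Sum>j\<in>G. \<Sum>k\<in>G. t j k)"
    by (subst sum.swap) (simp add: sum_negf)
  finally show ?thesis unfolding eq by simp
qed

text \<open>
  This bounds the rank of the exterior multiplication by \<open>a\<close>: since \<open>a \<and> a \<and> y = 0\<close>, the
  coordinates of \<open>a \<and> y\<close> at the sets containing \<open>i\<close> determine the others.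
\<close>

lemma wedge_eq_0_if_pivot_rows:
  assumes I: "finite I" "i \<in> I" "a i \<noteq> 0"
    and B: "\<And>c. c \<in> X \<Longrightarrow> B c \<subseteq> I"
    and pivot: "\<And>E. E \<subseteq> I \<Longrightarrow> card E = q \<Longrightarrow> i \<in> E \<Longrightarrow> (\<Sum>c\<in>X. wedge_coeff I a E (B c) * y c) = 0"
    and D: "D \<subseteq> I" "card D = q"
  shows "(\<Sum>c\<in>X. wedge_coeff I a D (B c) * y c) = 0"
proof (cases "i \<in> D")
  case True
  then show ?thesis using pivot D by blast
next
  case False
  let ?G = "insert i D"
  let ?z = "\<lambda>E. \<Sum>c\<in>X. wedge_coeff I a E (B c) * y c"
  let ?s = "\<lambda>j. ext_sign j (?G - {j}) * a j"
  have fin: "finite D" using D I finite_subset by blast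
  have z0: "?z (?G - {j}) = 0" if "j \<in> D" for j
  proof (rule pivot)
    show "?G - {j} \<subseteq> I" "i \<in> ?G - {j}" using D I False that by auto
    show "card (?G - {j}) = q" using D fin False that by simp
  qed
  \<comment> \<open>The added sum consists of pivot rows and vanishes; it completes the left side to
    the coordinate of \<open>a \<and> (a \<and> y)\<close> at \<open>?G\<close>, which is 0.\<close>
  have "?s i * ?z D = ?s i * ?z (?G - {i}) + (\<Sum>j\<in>D. ?s j * ?z (?G - {j}))"
    using False z0 by simp
  also have "\<dots> = (\<Sum>j\<in>?G. ?s j * ?z (?G - {j}))"
    using False fin by simp
  also have "\<dots> = (\<Sum>c\<in>X. (\<Sum>j\<in>?G. ?s j * wedge_coeff I a (?G - {j}) (B c)) * y c)"
    unfolding sum_distrib_left sum_distrib_right by (subst sum.swap) (simp only: mult.assoc)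
  also have "\<dots> = 0"
    using wedge_wedge_eq_0[of I ?G] I D B by (intro sum.neutral) auto
  finally show ?thesis using I by simp
qed

text \<open>
  Columns are pairs \<open>(A, B)\<close>, rows are pairs \<open>(C, D)\<close>; only squarefree exponents \<open>A\<close> and \<open>C\<close> are
  kept. The factor \<open>mfact m\<close> turns the \<open>m\<close>-th coordinate of the \<open>d\<close>-th power of a linear form into
  \<open>fact d\<close> times the monomial \<open>m\<close> in its coefficients.
\<close>

fun flattening :: "'i::linorder set \<Rightarrow> 'i set \<times> 'i set \<Rightarrow> 'i set \<times> 'i set \<Rightarrow> ('i \<Rightarrow>\<^sub>0 nat) poly_C" where
  "flattening I (C, D) (A, B) = (\<Sum>j\<in>I. if j \<notin> B \<and> D = insert j B
     then Poly_Mapping.single (Poly_Mapping.single (sqfree A + sqfree C + Poly_Mapping.single j 1) 1)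
       (ext_sign j B * mfact (sqfree A + sqfree C + Poly_Mapping.single j 1))
     else 0)"

lemma homogeneous_flattening: "homogeneous 1 (flattening I cd ab)"
  by (cases cd; cases ab) (auto intro!: homogeneous_sum)

lemma peval_flattening:
  "peval (flattening I (C, D) (A, B)) u = (\<Sum>j\<in>I. if j \<notin> B \<and> D = insert j B
     then ext_sign j B * (mfact (sqfree A + sqfree C + Poly_Mapping.single j 1) *
       u (sqfree A + sqfree C + Poly_Mapping.single j 1)) else 0)"
  by (auto simp: peval_sum if_distrib[of "\<lambda>F. peval F u"] intro!: sum.cong)

text \<open>The value of the exponent factors into parts for \<open>A\<close>, \<open>C\<close> and
  \<open>j\<close>: a rank one matrix in \<open>C\<close> and \<open>A\<close>, tensored with
  exterior multiplication by \<open>a\<close>.\<close>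

lemma peval_flattening_linear_form_power:
  assumes I: "finite I" "A \<subseteq> I" "C \<subseteq> I" and d: "card A + card C + 1 = d"
  shows "peval (flattening I (C, D) (A, B)) (Poly_Mapping.lookup (linear_form I a ^ d)) =
    fact d * prod a C * (prod a A * wedge_coeff I a D B)"
  unfolding peval_flattening wedge_coeff_def sum_distrib_left
proof (rule sum.cong[OF refl])
  fix j assume j: "j \<in> I"
  have fin: "finite A" "finite C" using I finite_subset by auto
  let ?m = "sqfree A + sqfree C + Poly_Mapping.single j (1::nat)"
  have "Poly_Mapping.keys ?m \<subseteq> I"
    using I j fin by (auto simp: in_keys_iff Poly_Mapping.lookup_add Poly_Mapping.lookup_single
        lookup_sqfree when_def split: if_splits)
  moreover have "mdegree ?m = d"
    using d fin by (simp add: mdegree_add mdegree_sqfree)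
  ultimately have eq: "mfact ?m * Poly_Mapping.lookup (linear_form I a ^ d) ?m =
      fact d * (prod a A * prod a C * a j)"
    using lookup_linear_form_power[OF I(1)] fin by (simp add: meval_add meval_sqfree)
  show "(if j \<notin> B \<and> D = insert j B then ext_sign j B * (mfact ?m *
        Poly_Mapping.lookup (linear_form I a ^ d) ?m) else 0) =
      fact d * prod a C * (prod a A * (if j \<notin> B \<and> D = insert j B then ext_sign j B * a j else 0))"
    unfolding eq by simp
qed

lemma peval_flattening_monomial:
  assumes "finite I"
  shows "peval (flattening I (C, D) (A, B)) (Poly_Mapping.lookup (\<Prod>i\<in>I. Var i)) =
    (\<Sum>j\<in>I. if j \<notin> B \<and> D = insert j B \<and>
        sqfree A + sqfree C + Poly_Mapping.single j 1 = sqfree I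
      then ext_sign j B else 0)"
  using assms unfolding peval_flattening prod_Var
  by (intro sum.cong[OF refl])
     (auto simp: Poly_Mapping.lookup_single when_def mfact_sqfree)

text \<open>
  The multidegree of \<open>(A, B)\<close> counts a variable once for \<open>I - A\<close> and once for \<open>B\<close>; the core consists
  of the variables of multiplicity one, the others belonging to \<open>A - B\<close> or \<open>B - A\<close>.
\<close>

definition core :: "'i set \<Rightarrow> 'i set \<Rightarrow> 'i set \<Rightarrow> 'i set" where
  "core I A B = (I - (A \<union> B)) \<union> (A \<inter> B)"

text \<open>In a block with core \<open>T\<close> of \<open>2 s + 1\<close> elements,
  \<open>A \<inter> B\<close> runs over the \<open>s\<close>-subsets of \<open>T\<close>. The
  columns kept are those whose \<open>A \<inter> B\<close> avoids the least element of
  \<open>T\<close>.\<close>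

definition pivots :: "'i::linorder set \<Rightarrow> nat \<Rightarrow> ('i set \<times> 'i set) set" where
  "pivots I n = {(A, B). A \<subseteq> I \<and> card A = n \<and> B \<subseteq> I \<and> card B = n \<and> Min (core I A B) \<notin> A \<union> B}"

text \<open>The row reached by adjoining the least core element \<open>t\<close> to
  \<open>B\<close>; \<open>A\<close>, the first component and \<open>{t}\<close> then partition
  \<open>I\<close>.\<close>

fun pivot_row :: "'i::linorder set \<Rightarrow> 'i set \<times> 'i set \<Rightarrow> 'i set \<times> 'i set" where
  "pivot_row I (A, B) = (I - A - {Min (core I A B)}, insert (Min (core I A B)) B)"

text \<open>Two \<open>n\<close>-sets cannot cover \<open>2 n + 1\<close> elements, so the core is
  nonempty and \<open>Min\<close> really picks one of its elements.\<close>

lemma pivotsD: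
  assumes I: "finite I" "card I = 2 * n + 1" and AB: "(A, B) \<in> pivots I n"
  shows "A \<subseteq> I" "card A = n" "B \<subseteq> I" "card B = n"
    "Min (core I A B) \<in> I" "Min (core I A B) \<notin> A" "Min (core I A B) \<notin> B"
proof -
  show *: "A \<subseteq> I" "card A = n" "B \<subseteq> I" "card B = n"
    "Min (core I A B) \<notin> A" "Min (core I A B) \<notin> B"
    using AB by (auto simp: pivots_def)
  have "card (A \<union> B) < card I"
    using card_Un_le[of A B] * I by simp
  then have "\<not> I \<subseteq> A \<union> B"
    using card_mono[of "A \<union> B" I] finite_subset[OF *(1) I(1)] finite_subset[OF *(3) I(1)] by auto
  then have "core I A B \<noteq> {}" by (auto simp: core_def)
  moreover have "finite (core I A B)"
    using I * by (auto simp: core_def intro: finite_subset)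
  ultimately have "Min (core I A B) \<in> core I A B"
    by (intro Min_in)
  then show "Min (core I A B) \<in> I"
    using * by (auto simp: core_def)
qed

lemma finite_pivots: "finite I \<Longrightarrow> finite (pivots I n)"
  by (rule finite_subset[of _ "Pow I \<times> Pow I"]) (auto simp: pivots_def)

text \<open>Both sides say that \<open>A\<close>, \<open>C\<close> and \<open>{j}\<close> partition
  \<open>I\<close>.\<close>

lemma sqfree_sum_eq_iff:
  assumes "finite I" "A \<subseteq> I" "C \<subseteq> I" "j \<in> I"
  shows "sqfree A + sqfree C + Poly_Mapping.single j 1 = sqfree I \<longleftrightarrow> C = I - A - {j} \<and> j \<notin> A"
proof -
  have fin: "finite A" "finite C" using assms finite_subset by auto
  have "sqfree A + sqfree C + Poly_Mapping.single j 1 = sqfree I \<longleftrightarrow>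
      (\<forall>i. (if i \<in> A then 1 else 0) + (if i \<in> C then 1 else 0) + (if i = j then 1 else 0) =
        (if i \<in> I then 1 else (0::nat)))"
    using fin assms(1) by (auto simp: poly_mapping_eq_iff fun_eq_iff Poly_Mapping.lookup_add
        lookup_sqfree Poly_Mapping.lookup_single when_def)
  also have "\<dots> \<longleftrightarrow> C = I - A - {j} \<and> j \<notin> A"
  proof
    assume *: "\<forall>i. (if i \<in> A then 1 else 0) + (if i \<in> C then 1 else 0) + (if i = j then 1 else 0) =
        (if i \<in> I then 1 else (0::nat))"
    have "i \<in> C \<longleftrightarrow> i \<in> I - A - {j}" for i
      using spec[OF *, of i] assms by (auto split: if_splits)
    moreover have "j \<notin> A"
      using spec[OF *, of j] assms(4) by (auto split: if_splits)
    ultimately show "C = I - A - {j} \<and> j \<notin> A" by blast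
  next
    assume "C = I - A - {j} \<and> j \<notin> A"
    then show "\<forall>i. (if i \<in> A then 1 else 0) + (if i \<in> C then 1 else 0) + (if i = j then 1 else 0) =
        (if i \<in> I then 1 else (0::nat))"
      using assms by auto
  qed
  finally show ?thesis .
qed

text \<open>The exterior component alone forces \<open>j\<close> to be the least core element, so a
  single sign survives.\<close>

lemma pivot_diagonal:
  assumes I: "finite I" "card I = 2 * n + 1" and ab: "ab \<in> pivots I n"
  shows "peval (flattening I (pivot_row I ab) ab) (Poly_Mapping.lookup (\<Prod>i\<in>I. Var i)) \<noteq> 0"
proof -
  obtain A B where AB: "ab = (A, B)" by (cases ab)
  note * = pivotsD[OF I ab[unfolded AB]]
  let ?t = "Min (core I A B)"
  have "peval (flattening I (pivot_row I ab) ab) (Poly_Mapping.lookup (\<Prod>i\<in>I. Var i)) =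
      (\<Sum>j\<in>I. if j = ?t then ext_sign j B else 0)"
    unfolding AB pivot_row.simps peval_flattening_monomial[OF I(1)]
  proof (rule sum.cong[OF refl])
    fix j assume "j \<in> I"
    then have "j \<notin> B \<and> insert ?t B = insert j B \<and>
        sqfree A + sqfree (I - A - {?t}) + Poly_Mapping.single j 1 = sqfree I \<longleftrightarrow> j = ?t"
      using * I by (subst sqfree_sum_eq_iff) auto
    then show "(if j \<notin> B \<and> insert ?t B = insert j B \<and>
        sqfree A + sqfree (I - A - {?t}) + Poly_Mapping.single j 1 = sqfree I
      then ext_sign j B else 0) = (if j = ?t then ext_sign j B else 0)"
      by (simp only:)
  qed
  then show ?thesis using * I by simp
qed

text \<open>
  A nonzero entry forces \<open>insert j A = insert t A'\<close> and \<open>insert j B = insert t B'\<close>, where \<open>t\<close> is the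
  least element of the core of \<open>(A', B')\<close>. These equations imply that the cores of \<open>(A, B)\<close> and
  \<open>(A', B')\<close> agree, so \<open>t\<close> lies neither in \<open>A\<close> nor in \<open>B\<close>, which leaves \<open>j = t\<close>.
\<close>

lemma pivot_offdiagonal:
  assumes I: "finite I" "card I = 2 * n + 1" and ab: "ab \<in> pivots I n" "ab' \<in> pivots I n" "ab' \<noteq> ab"
  shows "peval (flattening I (pivot_row I ab') ab) (Poly_Mapping.lookup (\<Prod>i\<in>I. Var i)) = 0"
proof -
  obtain A B A' B' where AB: "ab = (A, B)" "ab' = (A', B')" by (cases ab; cases ab') auto
  note piv = pivotsD[OF I ab(1)[unfolded AB]] and piv' = pivotsD[OF I ab(2)[unfolded AB]]
  define t where "t = Min (core I A' B')"
  have False if j: "j \<in> I" "j \<notin> B" "insert t B' = insert j B"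
    "sqfree A + sqfree (I - A' - {t}) + Poly_Mapping.single j 1 = sqfree I" for j
  proof -
    have t: "t \<in> I" "t \<notin> A'" "t \<notin> B'" using piv' by (simp_all add: t_def)
    have C: "I - A' - {t} = I - A - {j}" and jA: "j \<notin> A"
      using sqfree_sum_eq_iff[OF I(1) piv(1) _ j(1), of "I - A' - {t}"] j(4) by blast+
    have A: "A = insert t A' - {j}" "j \<in> insert t A'"
      using C jA j(1) t piv(1) piv'(1) by blast+
    have B: "B = insert t B' - {j}" "j \<in> insert t B'"
      using j(2,3) by blast+
    have "core I A B = core I A' B'"
      unfolding A(1) B(1) core_def using A(2) B(2) t j(1) by auto
    then have "t \<notin> A" using piv(6) by (simp add: t_def)
    then have "j = t" using A(1) by blast
    then have "A = A'" "B = B'" using A(1) B(1) t by simp_all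
    then show False using ab(3) AB by simp
  qed
  then show ?thesis
    unfolding AB pivot_row.simps peval_flattening_monomial[OF I(1)] t_def[symmetric]
    by (intro sum.neutral) auto
qed

lemma card_subsets_containing:
  assumes "finite I" "i \<in> I"
  shows "card {E. E \<subseteq> I \<and> card E = Suc k \<and> i \<in> E} = (card I - 1) choose k"
proof -
  have "{E. E \<subseteq> I \<and> card E = Suc k \<and> i \<in> E} = insert i ` {E. E \<subseteq> I - {i} \<and> card E = k}"
  proof (intro equalityI subsetI)
    fix E assume "E \<in> {E. E \<subseteq> I \<and> card E = Suc k \<and> i \<in> E}"
    then have "E = insert i (E - {i})" "E - {i} \<in> {E. E \<subseteq> I - {i} \<and> card E = k}"
      by auto
    then show "E \<in> insert i ` {E. E \<subseteq> I - {i} \<and> card E = k}" by blast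
  next
    fix E assume "E \<in> insert i ` {E. E \<subseteq> I - {i} \<and> card E = k}"
    then obtain F where F: "E = insert i F" "F \<subseteq> I - {i}" "card F = k" by blast
    then have "finite F" "i \<notin> F" using assms finite_subset[of F I] by auto
    then show "E \<in> {E. E \<subseteq> I \<and> card E = Suc k \<and> i \<in> E}" using F assms by auto
  qed
  moreover have "inj_on (insert i) {E. E \<subseteq> I - {i} \<and> card E = k}"
    by (rule inj_onI) auto
  ultimately show ?thesis
    using assms by (simp add: card_image n_subsets)
qed

lemma card_pivots_le:
  assumes I: "finite I" "card I = 2 * n + 1"
    and r: "proj_point (\<Prod>i\<in>I. Var i) \<in>
      secant_variety (sym_power (2 * n + 1) I) r (veronese (2 * n + 1) I)"
  shows "card (pivots I n) \<le> r * ((2 * n) choose n)"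
proof -
  let ?d = "2 * n + 1"
  define S where "S = {z \<in> sym_power ?d I. \<exists>w\<in>sym_power 1 I. z = w ^ ?d}"
  have "\<exists>a. \<exists>i\<in>I. x = linear_form I a ^ ?d \<and> a i \<noteq> 0" if x: "x \<in> S - {0}" for x
  proof -
    obtain w where "w \<in> sym_power 1 I" "x = w ^ ?d" using x unfolding S_def by blast
    then obtain a where a: "x = linear_form I a ^ ?d" using sym_power_1E[OF _ I(1)] by metis
    \<comment> \<open>Otherwise the power would be 0, its exponent being positive.\<close>
    have "\<exists>i\<in>I. a i \<noteq> 0"
    proof (rule ccontr)
      assume "\<not> ?thesis"
      then have "linear_form I a = 0" by (simp add: linear_form_def)
      then show False using a x by simp
    qed
    then show ?thesis using a by blast
  qed
  then obtain a i where ai: "\<And>x. x \<in> S - {0} \<Longrightarrow> i x \<in> I"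
    "\<And>x. x \<in> S - {0} \<Longrightarrow> x = linear_form I (a x) ^ ?d"
    "\<And>x. x \<in> S - {0} \<Longrightarrow> a x (i x) \<noteq> 0"
    by metis
  \<comment> \<open>Since \<open>a x\<close> is nonzero at \<open>i x\<close>, the rows containing
    \<open>i x\<close> determine \<open>a x \<and> y\<close>; there are \<open>2 n choose n\<close>
    such sets of size \<open>n + 1\<close>.\<close>
  define J where "J x = {E. E \<subseteq> I \<and> card E = Suc n \<and> i x \<in> E}" for x
  define g where "g x E ab = prod (a x) (fst ab) * wedge_coeff I (a x) E (snd ab)" for x E ab
  show ?thesis
  proof (rule secant_variety_flattening_bound[where J = J and g = g and S = S])
    show "finite (pivots I n)" using I by (simp add: finite_pivots)
  next
    fix ab ab' show "homogeneous 1 (flattening I (pivot_row I ab) ab')"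
      by (rule homogeneous_flattening)
  next
    fix x assume "x \<in> S - {0}"
    then show "finite (J x) \<and> card (J x) \<le> (2 * n) choose n"
      using I ai(1) by (simp add: J_def card_subsets_containing)
  next
    fix x v ab assume x: "x \<in> S - {0}" and ker: "\<And>k. k \<in> J x \<Longrightarrow> (\<Sum>j\<in>pivots I n. g x k j * v j) = 0"
      and ab: "ab \<in> pivots I n"
    obtain C D where CD: "pivot_row I ab = (C, D)" "C \<subseteq> I" "card C = n" "D \<subseteq> I" "card D = Suc n"
    proof -
      obtain A B where AB: "ab = (A, B)" by (cases ab)
      note * = pivotsD[OF I ab[unfolded AB]]
      have "finite A" "finite B" using * I finite_subset by auto
      then show thesis
        using * I that[of "I - A - {Min (core I A B)}" "insert (Min (core I A B)) B"]
        by (auto simp: AB card_Diff_subset)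
    qed
    let ?a = "a x"
    \<comment> \<open>The symmetric factor of each column is absorbed into the vector, leaving only
      exterior multiplication.\<close>
    have zero: "(\<Sum>c\<in>pivots I n. wedge_coeff I ?a D (snd c) * (prod ?a (fst c) * v c)) = 0"
    proof (rule wedge_eq_0_if_pivot_rows[where a = "a x" and i = "i x", OF I(1) ai(1)[OF x] ai(3)[OF x]])
      show "snd c \<subseteq> I" if "c \<in> pivots I n" for c
        using that by (auto simp: pivots_def)
      show "(\<Sum>c\<in>pivots I n. wedge_coeff I ?a E (snd c) * (prod ?a (fst c) * v c)) = 0"
        if "E \<subseteq> I" "card E = Suc n" "i x \<in> E" for E
        using ker[of E] that by (simp add: J_def g_def mult_ac)
    qed (use CD in auto)
    have "(\<Sum>c\<in>pivots I n. peval (flattening I (pivot_row I ab) c) (Poly_Mapping.lookup x) * v c) =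
        (\<Sum>c\<in>pivots I n. fact ?d * prod ?a C *
          (wedge_coeff I ?a D (snd c) * (prod ?a (fst c) * v c)))"
    proof (rule sum.cong[OF refl])
      fix c assume c: "c \<in> pivots I n"
      then have "peval (flattening I (C, D) (fst c, snd c)) (Poly_Mapping.lookup x) =
          fact ?d * prod ?a C * (prod ?a (fst c) * wedge_coeff I ?a D (snd c))"
        using I CD by (subst ai(2)[OF x], intro peval_flattening_linear_form_power)
          (auto simp: pivots_def)
      then show "peval (flattening I (pivot_row I ab) c) (Poly_Mapping.lookup x) * v c =
          fact ?d * prod ?a C * (wedge_coeff I ?a D (snd c) * (prod ?a (fst c) * v c))"
        by (simp add: CD mult_ac)
    qed
    also have "\<dots> = 0"
      unfolding sum_distrib_left[symmetric] zero by simp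
    finally show "(\<Sum>c\<in>pivots I n. peval (flattening I (pivot_row I ab) c)
      (Poly_Mapping.lookup x) * v c) = 0" .
  next
    show "(\<Prod>i\<in>I. Var i) \<noteq> (0 :: 'a poly_C)"
      by (rule prod_Var_nonzero)
  next
    show "proj_point (\<Prod>i\<in>I. Var i) \<in> secant_variety (sym_power ?d I) r (proj S)"
      using r by (simp add: S_def veronese_def)
  qed (use pivot_diagonal[OF I] pivot_offdiagonal[OF I] in auto)
qed

section \<open>The size of the nonsingular minor\<close>

definition subset_pairs :: "'i set \<Rightarrow> nat \<Rightarrow> ('i set \<times> 'i set) set" where
  "subset_pairs I n = {A. A \<subseteq> I \<and> card A = n} \<times> {B. B \<subseteq> I \<and> card B = n}"

lemma finite_subset_pairs: "finite I \<Longrightarrow> finite (subset_pairs I n)"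
  by (rule finite_subset[of _ "Pow I \<times> Pow I"]) (auto simp: subset_pairs_def)

lemma card_subset_pairs: "finite I \<Longrightarrow> card (subset_pairs I n) = (card I choose n)\<^sup>2"
  by (simp add: subset_pairs_def card_cartesian_product n_subsets power2_eq_square)

text \<open>The fraction of pivots in a block, \<open>(2 s choose s) / (2 s + 1 choose s)\<close>,
  where \<open>s\<close> is the size of the intersection.\<close>

definition pivot_ratio :: "'i set \<times> 'i set \<Rightarrow> real" where
  "pivot_ratio p = (real (card (fst p \<inter> snd p)) + 1) / (2 * real (card (fst p \<inter> snd p)) + 1)"

text \<open>Pairs with fixed differences \<open>U\<close> and \<open>V\<close> are determined by
  their intersection, an arbitrary \<open>s\<close>-subset \<open>Y\<close> of the core
  \<open>T\<close>. The ratio is constant on them, and the pivots are given by the \<open>Y\<close>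
  avoiding \<open>Min T\<close>.\<close>

lemma sum_pivots_fibre:
  fixes I :: "'i::linorder set"
  assumes I: "finite I" "card I = 2 * n + 1" and p0: "(A0, B0) \<in> subset_pairs I n"
  defines "F \<equiv> {p \<in> subset_pairs I n. (fst p - snd p, snd p - fst p) = (A0 - B0, B0 - A0)}"
  shows "(\<Sum>p\<in>F. if p \<in> pivots I n then 1 else 0) = (\<Sum>p\<in>F. pivot_ratio p)"
proof -
  define U V T s where "U = A0 - B0" and "V = B0 - A0" and "T = I - (U \<union> V)"
    and "s = card (A0 \<inter> B0)"
  have AB: "A0 \<subseteq> I" "B0 \<subseteq> I" "card A0 = n" "card B0 = n"
    using p0 by (auto simp: subset_pairs_def)
  have fin: "finite A0" "finite B0" "finite U" "finite V" "finite T"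
    using I(1) finite_subset[OF AB(1) I(1)] finite_subset[OF AB(2) I(1)]
    unfolding U_def V_def T_def by auto
  have cU: "card U + s = n" and cV: "card V + s = n"
    using AB fin card_Int_Diff[of A0 B0] card_Int_Diff[of B0 A0]
    by (simp_all add: U_def V_def s_def Int_commute)
  have "card (U \<union> V) = card U + card V"
    using fin by (intro card_Un_disjoint) (auto simp: U_def V_def)
  \<comment> \<open>\<open>2 n + 1 - 2 (n - s) = 2 s + 1\<close>.\<close>
  then have cT: "card T = 2 * s + 1"
    using fin AB I cU cV unfolding T_def
    by (subst card_Diff_subset) (auto simp: U_def V_def)
  then have "T \<noteq> {}" by auto
  then have minT: "Min T \<in> T" using fin by simp
  have UV: "U \<subseteq> I" "V \<subseteq> I" "U \<inter> V = {}" "T \<inter> U = {}" "T \<inter> V = {}" "T \<subseteq> I"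
    using AB by (auto simp: U_def V_def T_def)
  define X where "X = {X. X \<subseteq> T \<and> card X = s}"
  define f where "f Y = (U \<union> Y, V \<union> Y)" for Y
  have finX: "finite Y" if "Y \<in> X" for Y
    using that fin finite_subset by (auto simp: X_def)
  have f_int: "fst (f Y) \<inter> snd (f Y) = Y" if "Y \<in> X" for Y
    using that UV by (auto simp: f_def X_def)
  have f_core: "core I (U \<union> Y) (V \<union> Y) = T" if "Y \<in> X" for Y
    using that UV by (auto simp: core_def X_def T_def)
  have f_pairs: "f Y \<in> subset_pairs I n" if "Y \<in> X" for Y
  proof -
    have "card (U \<union> Y) = n" "card (V \<union> Y) = n"
      using that UV fin finX[OF that] cU cV by (subst card_Un_disjoint; auto simp: X_def)+
    then show ?thesis using that UV by (auto simp: f_def subset_pairs_def X_def)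
  qed
  have F: "F = f ` X"
  proof (intro equalityI subsetI)
    fix p assume "p \<in> F"
    then obtain A B where p: "p = (A, B)" "A \<subseteq> I" "B \<subseteq> I" "card A = n" "A - B = U" "B - A = V"
      by (cases p) (auto simp: F_def subset_pairs_def U_def V_def)
    have "card A = card (A \<inter> B) + card U"
      using p I(1) card_Int_Diff[of A B] finite_subset by metis
    then have "A \<inter> B \<in> X"
      using p cU by (auto simp: X_def T_def)
    moreover have "p = f (A \<inter> B)"
      using p by (auto simp: f_def)
    ultimately show "p \<in> f ` X" by blast
  next
    fix p assume "p \<in> f ` X"
    then obtain Y where Y: "Y \<in> X" "p = f Y" by blast
    then have "U \<union> Y - (V \<union> Y) = U" "V \<union> Y - (U \<union> Y) = V"
      using UV by (auto simp: X_def)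
    then show "p \<in> F"
      using f_pairs Y by (simp add: F_def f_def U_def V_def)
  qed
  have inj: "inj_on f X"
    using f_int by (metis inj_onI)
  have piv: "f Y \<in> pivots I n \<longleftrightarrow> Min T \<notin> Y" if "Y \<in> X" for Y
    using f_pairs[OF that] f_core[OF that] minT UV
    by (auto simp: pivots_def f_def subset_pairs_def)
  have finite_X: "finite X" using fin by (simp add: X_def)
  have "(\<Sum>p\<in>F. if p \<in> pivots I n then 1 else 0) = (\<Sum>Y\<in>X. if Min T \<notin> Y then 1 else (0::real))"
    unfolding F sum.reindex[OF inj] using piv by (intro sum.cong) auto
  also have "\<dots> = real (card {Y \<in> X. Min T \<notin> Y})"
    using finite_X by (simp add: sum.If_cases Int_def)
  also have "{Y \<in> X. Min T \<notin> Y} = {Y. Y \<subseteq> T - {Min T} \<and> card Y = s}"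
    by (auto simp: X_def)
  also have "card \<dots> = (2 * s) choose s"
    using fin minT cT by (subst n_subsets) auto
  also have "real ((2 * s) choose s) = real ((2 * s + 1) choose s) * ((real s + 1) / (2 * real s + 1))"
  proof -
    have "Suc (2 * s) * ((2 * s) choose s) = (Suc (2 * s) choose Suc s) * Suc s"
      by (rule Suc_times_binomial_eq)
    also have "Suc (2 * s) choose Suc s = Suc (2 * s) choose s"
      by (subst binomial_symmetric) auto
    finally have "real (Suc (2 * s) * ((2 * s) choose s)) = real ((Suc (2 * s) choose s) * Suc s)"
      by (simp only:)
    then show ?thesis by (simp add: field_simps)
  qed
  also have "\<dots> = (\<Sum>Y\<in>X. (real s + 1) / (2 * real s + 1))"
    using fin cT by (simp add: X_def n_subsets)
  also have "\<dots> = (\<Sum>Y\<in>X. pivot_ratio (f Y))"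
    by (intro sum.cong refl) (simp add: pivot_ratio_def f_int X_def)
  also have "\<dots> = (\<Sum>p\<in>F. pivot_ratio p)"
    unfolding F sum.reindex[OF inj] by simp
  finally show ?thesis .
qed

lemma card_pivots:
  fixes I :: "'i::linorder set"
  assumes I: "finite I" "card I = 2 * n + 1"
  shows "real (card (pivots I n)) = (\<Sum>p\<in>subset_pairs I n. pivot_ratio p)"
proof -
  let ?Q = "subset_pairs I n" and ?\<phi> = "\<lambda>p. (fst p - snd p, snd p - fst p)"
  have fin: "finite ?Q" using I by (simp add: finite_subset_pairs)
  have "pivots I n \<subseteq> ?Q" by (auto simp: pivots_def subset_pairs_def)
  then have "real (card (pivots I n)) = (\<Sum>p\<in>?Q. if p \<in> pivots I n then 1 else 0)"
    using fin by (simp add: sum.If_cases Int_absorb1)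
  also have "\<dots> = (\<Sum>q\<in>?\<phi> ` ?Q. \<Sum>p\<in>{p \<in> ?Q. ?\<phi> p = q}. if p \<in> pivots I n then 1 else 0)"
    by (rule sum.image_gen[OF fin])
  also have "\<dots> = (\<Sum>q\<in>?\<phi> ` ?Q. \<Sum>p\<in>{p \<in> ?Q. ?\<phi> p = q}. pivot_ratio p)"
  proof (rule sum.cong[OF refl])
    fix q assume "q \<in> ?\<phi> ` ?Q"
    then obtain A B where "(A, B) \<in> ?Q" "q = (A - B, B - A)" by auto
    then show "(\<Sum>p\<in>{p \<in> ?Q. ?\<phi> p = q}. if p \<in> pivots I n then 1 else 0) =
        (\<Sum>p\<in>{p \<in> ?Q. ?\<phi> p = q}. pivot_ratio p)"
      using sum_pivots_fibre[OF I] by simp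
  qed
  also have "\<dots> = (\<Sum>p\<in>?Q. pivot_ratio p)"
    by (rule sum.image_gen[OF fin, symmetric])
  finally show ?thesis .
qed

text \<open>Double counting: each \<open>i\<close> lies in both members of
  \<open>(k choose m)^2\<close> pairs.\<close>

lemma sum_card_inter:
  assumes I: "finite I" "card I = Suc k"
  shows "(\<Sum>p\<in>subset_pairs I (Suc m). card (fst p \<inter> snd p)) = Suc k * (k choose m)\<^sup>2"
proof -
  let ?S = "{A. A \<subseteq> I \<and> card A = Suc m}"
  have fin: "finite ?S" using I by simp
  have c: "(\<Sum>A\<in>?S. if i \<in> A then 1 else 0) = k choose m" if "i \<in> I" for i
  proof -
    have "(\<Sum>A\<in>?S. if i \<in> A then 1 else 0) = card {A \<in> ?S. i \<in> A}"
      using fin by (simp add: sum.If_cases Int_def)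
    also have "{A \<in> ?S. i \<in> A} = {A. A \<subseteq> I \<and> card A = Suc m \<and> i \<in> A}" by auto
    finally show ?thesis using card_subsets_containing[OF I(1) that] I by simp
  qed
  have inter: "card (A \<inter> B) = (\<Sum>i\<in>I. (if i \<in> A then 1 else 0) * (if i \<in> B then 1 else 0))"
    if "A \<subseteq> I" for A B
  proof -
    have "(\<Sum>i\<in>I. (if i \<in> A then 1 else 0) * (if i \<in> B then 1 else 0)) =
        (\<Sum>i\<in>I. if i \<in> A \<inter> B then 1 else (0::nat))"
      by (intro sum.cong) auto
    also have "\<dots> = (\<Sum>i\<in>A \<inter> B. 1)"
      using that I(1) by (intro sum.mono_neutral_cong_right) auto
    finally show ?thesis by simp
  qed
  have "(\<Sum>p\<in>subset_pairs I (Suc m). card (fst p \<inter> snd p)) =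
      (\<Sum>A\<in>?S. \<Sum>B\<in>?S. card (A \<inter> B))"
    by (simp add: subset_pairs_def sum.cartesian_product split_def)
  also have "\<dots> = (\<Sum>A\<in>?S. \<Sum>B\<in>?S. \<Sum>i\<in>I. (if i \<in> A then 1 else 0) * (if i \<in> B then 1 else 0))"
    by (intro sum.cong refl inter) simp
  also have "\<dots> = (\<Sum>A\<in>?S. \<Sum>i\<in>I. \<Sum>B\<in>?S. (if i \<in> A then 1 else 0) * (if i \<in> B then 1 else 0))"
    by (intro sum.cong refl sum.swap)
  also have "\<dots> = (\<Sum>i\<in>I. \<Sum>A\<in>?S. \<Sum>B\<in>?S. (if i \<in> A then 1 else 0) * (if i \<in> B then 1 else 0))"
    by (rule sum.swap)
  also have "\<dots> = (\<Sum>i\<in>I. (\<Sum>A\<in>?S. if i \<in> A then 1 else 0) * (\<Sum>B\<in>?S. if i \<in> B then 1 else 0))"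
    by (simp only: sum_product)
  also have "\<dots> = (\<Sum>i\<in>I. (k choose m)\<^sup>2)"
    using c by (intro sum.cong refl) (simp only: power2_eq_square)
  finally show ?thesis using I by simp
qed

text \<open>Jensen's inequality by a tangent line: the ratio is \<open>1/2 + 1/(2 y)\<close> with
  \<open>y = 2 s + 1\<close>, which is convex in \<open>y\<close>.\<close>

lemma card_pivots_ge:
  fixes I :: "'i::linorder set"
  assumes I: "finite I" "card I = 2 * n + 1" and n: "n \<ge> 1"
  shows "real (card (pivots I n)) \<ge>
    (real ((2 * n + 1) choose n))\<^sup>2 * ((real n + 1)\<^sup>2 / (2 * real n ^ 2 + 2 * real n + 1))"
proof -
  let ?Q = "subset_pairs I n"
  define M where "M = real ((2 * n + 1) choose n)"
  define x where "x = real n"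
  define s where "s p = real (card (fst p \<inter> snd p))" for p :: "'i set \<times> 'i set"
  obtain m where m: "n = Suc m" using n by (cases n) auto
  have x: "x \<ge> 1" using n by (simp add: x_def)
  have card_Q: "real (card ?Q) = M\<^sup>2"
    using I by (simp add: card_subset_pairs M_def)
  \<comment> \<open>The mean of \<open>s p\<close> over all pairs is
    \<open>x^2 / (2 x + 1)\<close>.\<close>
  have sum_s: "(2 * x + 1) * (\<Sum>p\<in>?Q. s p) = x\<^sup>2 * M\<^sup>2"
  proof -
    have "(\<Sum>p\<in>?Q. s p) = (2 * x + 1) * (real ((2 * n) choose m))\<^sup>2"
      using arg_cong[OF sum_card_inter[of I "2 * n" m], of real] I
      by (simp add: s_def m x_def algebra_simps)
    then have "(2 * x + 1) * (\<Sum>p\<in>?Q. s p) = ((2 * x + 1) * real ((2 * n) choose m))\<^sup>2"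
      by (simp add: power2_eq_square)
    also have "(2 * x + 1) * real ((2 * n) choose m) = M * x"
      using arg_cong[OF Suc_times_binomial_eq[of "2 * n" m], of real]
      by (simp add: M_def x_def m algebra_simps)
    finally show ?thesis by (simp add: power_mult_distrib)
  qed
  \<comment> \<open>The mean of \<open>2 * s p + 1\<close>, where the tangent is taken.\<close>
  define c where "c = (2 * x\<^sup>2 + 2 * x + 1) / (2 * x + 1)"
  have c: "c > 0" using x by (simp add: c_def add_pos_nonneg)
  have tangent: "1 / 2 + 1 / 2 * (2 / c - (2 * s p + 1) / c\<^sup>2) \<le> pivot_ratio p" for p
  proof -
    define y where "y = 2 * s p + 1"
    have y: "y > 0" by (simp add: y_def s_def add_nonneg_pos)
    have "0 \<le> (y - c)\<^sup>2 / (y * c\<^sup>2)" using y by simp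
    also have "\<dots> = 1 / y - (2 / c - y / c\<^sup>2)"
      using y c by (simp add: field_simps power2_eq_square)
    finally have "2 / c - y / c\<^sup>2 \<le> 1 / y" by simp
    then have "1 / 2 + 1 / 2 * (2 / c - y / c\<^sup>2) \<le> 1 / 2 + 1 / 2 * (1 / y)"
      by (intro add_left_mono mult_left_mono) auto
    also have "\<dots> = pivot_ratio p"
      using y by (simp add: pivot_ratio_def y_def s_def field_simps)
    finally show ?thesis unfolding y_def .
  qed
  have "(\<Sum>p\<in>?Q. 1 / 2 + 1 / 2 * (2 / c - (2 * s p + 1) / c\<^sup>2)) \<le> real (card (pivots I n))"
    unfolding card_pivots[OF I] by (intro sum_mono tangent)
  also have "(\<Sum>p\<in>?Q. 1 / 2 + 1 / 2 * (2 / c - (2 * s p + 1) / c\<^sup>2)) =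
      (\<Sum>p\<in>?Q. (1 / 2 + 1 / c - 1 / (2 * c\<^sup>2)) - (1 / c\<^sup>2) * s p)"
    using c by (intro sum.cong refl) (simp add: field_simps)
  also have "\<dots> = M\<^sup>2 * (1 / 2 + 1 / c - 1 / (2 * c\<^sup>2)) - (1 / c\<^sup>2) * (\<Sum>p\<in>?Q. s p)"
    by (simp add: sum_subtractf card_Q flip: sum_distrib_left sum_divide_distrib)
  also have "(\<Sum>p\<in>?Q. s p) = M\<^sup>2 * ((c - 1) / 2)"
    using sum_s x by (simp add: c_def field_simps)
  also have "M\<^sup>2 * (1 / 2 + 1 / c - 1 / (2 * c\<^sup>2)) - 1 / c\<^sup>2 * (M\<^sup>2 * ((c - 1) / 2)) =
      M\<^sup>2 * ((c + 1) / (2 * c))"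
    using c by (simp add: field_simps power2_eq_square)
  also have "(c + 1) / (2 * c) = (x + 1)\<^sup>2 / (2 * x\<^sup>2 + 2 * x + 1)"
  proof -
    have p: "2 * x + 1 \<noteq> 0" "2 * x\<^sup>2 + 2 * x + 1 \<noteq> 0"
      using x by (auto simp: add_nonneg_eq_0_iff)
    have ceq: "c + 1 = 2 * (x + 1)\<^sup>2 / (2 * x + 1)"
      using p by (simp add: c_def field_simps power2_eq_square)
    have cancel: "(2 * y / e) / (2 * (D / e)) = y / D" if "e \<noteq> 0" for y e D :: real
      using that by simp
    from ceq have "(c + 1) / (2 * c) = (2 * (x + 1)\<^sup>2 / (2 * x + 1)) / (2 * c)"
      by (simp only:)
    also have "\<dots> = (x + 1)\<^sup>2 / (2 * x\<^sup>2 + 2 * x + 1)"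
      unfolding c_def by (rule cancel[OF p(1)])
    finally show ?thesis .
  qed
  finally show ?thesis by (simp add: M_def x_def)
qed

section \<open>The resulting bound for secant varieties and for the border rank\<close>

lemma secant_variety_monomial_bound:
  fixes I :: "'i::linorder set"
  assumes I: "finite I" "card I = 2 * n + 1" and n: "n \<ge> 1"
    and r: "proj_point (\<Prod>i\<in>I. Var i) \<in>
      secant_variety (sym_power (2 * n + 1) I) r (veronese (2 * n + 1) I)"
  shows "real r \<ge> real ((2 * n + 1) choose n) * (1 + real n / (2 * real n ^ 2 + 2 * real n + 1))"
proof -
  define M x d where "M = real ((2 * n + 1) choose n)" and "x = real n"
    and "d = 2 * x\<^sup>2 + 2 * x + 1"
  have x: "x \<ge> 1" using n by (simp add: x_def)
  have d: "d > 0" using x by (simp add: d_def add_nonneg_pos)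
  have M: "M > 0" by (simp add: M_def)
  have "Suc (2 * n) * ((2 * n) choose n) = (Suc (2 * n) choose Suc n) * Suc n"
    by (rule Suc_times_binomial_eq)
  also have "Suc (2 * n) choose Suc n = Suc (2 * n) choose n"
    by (subst binomial_symmetric) auto
  finally have "real (Suc (2 * n) * ((2 * n) choose n)) = real ((Suc (2 * n) choose n) * Suc n)"
    by (simp only:)
  \<comment> \<open>Expresses the rank bound \<open>2 n choose n\<close> of a single power through
    \<open>M\<close>, so that \<open>M * (x + 1)\<close> can be cancelled.\<close>
  then have q: "(2 * x + 1) * real ((2 * n) choose n) = M * (x + 1)"
    by (simp add: M_def x_def algebra_simps)
  have "M\<^sup>2 * ((x + 1)\<^sup>2 / d) \<le> real (r * ((2 * n) choose n))"
    using card_pivots_ge[OF I n] card_pivots_le[OF I r]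
    unfolding M_def x_def d_def by linarith
  then have "(2 * x + 1) * (M\<^sup>2 * ((x + 1)\<^sup>2 / d)) \<le> (2 * x + 1) * real (r * ((2 * n) choose n))"
    using x by (intro mult_left_mono) auto
  also have "\<dots> = real r * ((2 * x + 1) * real ((2 * n) choose n))"
    by simp
  also have "\<dots> = (M * (x + 1)) * real r"
    unfolding q by simp
  also have "(2 * x + 1) * (M\<^sup>2 * ((x + 1)\<^sup>2 / d)) =
      (M * (x + 1)) * (M * ((2 * x + 1) * (x + 1) / d))"
    by (simp add: power2_eq_square)
  finally have "M * ((2 * x + 1) * (x + 1) / d) \<le> real r"
    using M x by (subst (asm) mult_le_cancel_left_pos) auto
  \<comment> \<open>\<open>(2 x + 1) (x + 1) = d + x\<close>.\<close>
  also have "(2 * x + 1) * (x + 1) / d = 1 + x / d"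
    using d by (simp add: field_simps) (simp add: d_def power2_eq_square algebra_simps)
  finally show ?thesis by (simp add: M_def x_def d_def)
qed

theorem theorem1p7:
  fixes n :: nat
  assumes "n \<ge> 1"
  shows "real (sym_border_rank (2 * n + 1) {1..2 * n + 1} (\<Prod>i\<in>{1..2 * n + 1}. Var i))
    \<ge> real ((2 * n + 1) choose n)
        * (1 + real n ^ 2 / ((real n + 1) ^ 2 * (2 * real n - 1)))"
proof -
  let ?I = "{1..2 * n + 1}" and ?r = "sym_border_rank (2 * n + 1) {1..2 * n + 1} (\<Prod>i\<in>{1..2 * n + 1}. Var i)"
  let ?M = "real ((2 * n + 1) choose n)"
  have "\<exists>r. proj_point (\<Prod>i\<in>?I. Var i) \<in>
      secant_variety (sym_power (2 * n + 1) ?I) r (veronese (2 * n + 1) ?I)"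
    using monomial_in_some_secant_variety[of ?I] by simp
  then have r0: "proj_point (\<Prod>i\<in>?I. Var i) \<in>
      secant_variety (sym_power (2 * n + 1) ?I) ?r (veronese (2 * n + 1) ?I)"
    unfolding sym_border_rank_def by (rule LeastI_ex)
  have r: "?M * (1 + real n / (2 * real n ^ 2 + 2 * real n + 1)) \<le> real ?r"
    by (rule secant_variety_monomial_bound[OF _ _ assms r0]) simp_all
  show ?thesis
  proof (cases "n = 1")
    case True
    \<comment> \<open>The claim asks for \<open>15 / 4\<close>, slightly more than
      \<open>18 / 5\<close>; integrality of the border rank closes the gap.\<close>
    have "real ?r \<ge> 18 / 5" using r by (simp add: True)
    then have "?r \<ge> 4" by linarith
    then have "real ?r \<ge> 4" by linarith
    then show ?thesis by (simp add: True)
  next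
    case False
    define x where "x = real n"
    have x: "x \<ge> 2" using False assms by (simp add: x_def)
    have "x\<^sup>2 / ((x + 1)\<^sup>2 * (2 * x - 1)) \<le> x / (2 * x\<^sup>2 + 2 * x + 1)"
    proof -
      \<comment> \<open>This is \<open>x (x^2 - x - 1)\<close>, the difference of the
        cross-multiplied sides; it would be negative at \<open>x = 1\<close>.\<close>
      have "0 \<le> x * (x * (x - 2) + (x - 1))" using x by simp
      then have "x\<^sup>2 * (2 * x\<^sup>2 + 2 * x + 1) \<le> x * ((x + 1)\<^sup>2 * (2 * x - 1))"
        by (simp add: power2_eq_square algebra_simps)
      moreover have "0 < (x + 1)\<^sup>2 * (2 * x - 1)" "0 < 2 * x\<^sup>2 + 2 * x + 1"
        using x by (auto simp: add_nonneg_pos)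
      ultimately show ?thesis by (simp add: divide_le_eq pos_le_divide_eq mult.commute)
    qed
    then have "?M * (1 + x\<^sup>2 / ((x + 1)\<^sup>2 * (2 * x - 1))) \<le> ?M * (1 + x / (2 * x\<^sup>2 + 2 * x + 1))"
      by (intro mult_left_mono) auto
    with r show ?thesis unfolding x_def by linarith
  qed
qed

end
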